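(* Let $a,b\ge3$. For any field $K$, let $Z\subset\mathbb P^3_K\subset\mathbb P^3_{\overline K}$ be $[a,b]$-geproci (as a subset of $\mathbb P^3_{\overline K}$) and let $\mathcal L=\{L_1,\dots,L_b\}$ be a set of $b$ skew lines with $a$ points of $Z$ on each line. Then $Z$ is an $\{a,b\}$-grid if and only if $|G_{\mathcal L}|=1$.
   Context: For distinct $i,j,k$ let $f_{ijk}\colon L_i\to L_j$ be the linear isomorphism sending $p\in L_i$ to the point where the plane spanned by $p$ and $L_k$ meets $L_j$. The groupoid $C_{\mathcal L}$ has the lines $L_i$ as objects and all possible compositions of the maps $f_{ijk}$ as arrows. The groups $\mathrm{Hom}_{C_{\mathcal L}}(L_i,L_i)$ are all isomorphic, and $G_{\mathcal L}$ denotes any of them. For a finite set $Z\subset\mathbb P^3_{\overline K}$, $\overline{Z}$ denotes its image under projection from a general point of $\mathbb P^3_{\overline K}$ to a plane $H$ (similarly $\overline L$ for a line $L$). A set $Z$ of $ab$ points is $\{a,b\}$-geproci if $\overline Z$ is the transverse intersection (in $ab$ distinct points) of plane curves in $H$ of degrees $a$ and $b$. An $\{a,b\}$-geproci set $Z$ is $[a,b]$-geproci if for some set $\mathcal L'$ of $b$ skew lines, $Z$ consists of $a$ points on each of the $b$ lines and $\overline Z$ is the transverse intersection of a plane curve of degree $a$ with $\bigcup_{L\in\mathcal L'}\overline L$. $Z$ is an $\{a,b\}$-grid if $Z=C_1\cap C_2$ where $C_1$ is a union of $a$ skew lines, $C_2$ a union of $b$ skew lines, and each component of $C_1$ meets each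 component of $C_2$ in exactly one point. *)

theory Defs
  imports
    "HOL-Analysis.Cartesian_Space"
    "HOL-Library.Poly_Mapping"
    "HOL-Library.FuncSet"
    "HOL-Algebra.Algebraic_Closure_Type"
begin

section \<open>Projective space and its linear subspaces\<close>

text \<open>
  A linear subspace of the projective space of \<open>'a ^ 'n\<close> is represented by the corresponding
  vector subspace, so that points, lines and planes are the subspaces of dimension 1, 2 and 3.
  The point \<open>p\<close> lies on the subspace \<open>L\<close> iff \<open>p \<subseteq> L\<close>, and the subspace spanned by \<open>A\<close> and
  \<open>B\<close> is \<open>vec.span (A \<union> B)\<close>.
\<close>

definition proj_point :: "('a::field ^ 'n) set \<Rightarrow> bool"
  where "proj_point p \<longleftrightarrow> vec.subspace p \<and> vec.dim p = 1"

definition proj_line :: "('a::field ^ 'n) set \<Rightarrow> bool"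
  where "proj_line L \<longleftrightarrow> vec.subspace L \<and> vec.dim L = 2"

definition proj_plane :: "('a::field ^ 'n) set \<Rightarrow> bool"
  where "proj_plane H \<longleftrightarrow> vec.subspace H \<and> vec.dim H = 3"

definition points_on :: "('a::field ^ 'n) set \<Rightarrow> ('a ^ 'n) set set"
  where "points_on L = {p. proj_point p \<and> p \<subseteq> L}"

definition skew_lines :: "('a::field ^ 'n) set set \<Rightarrow> bool"
  where "skew_lines \<L> \<longleftrightarrow>
    finite \<L> \<and> (\<forall>L\<in>\<L>. proj_line L) \<and>
    (\<forall>L\<in>\<L>. \<forall>M\<in>\<L>. L \<noteq> M \<longrightarrow> points_on L \<inter> points_on M = {})"

text \<open>Extension of scalars to the algebraic closure.\<close>

definition base_change :: "('a::field ^ 'n) set \<Rightarrow> ('a alg_closure ^ 'n) set"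
  where "base_change S = vec.span ((\<lambda>v. \<chi> i. to_ac (v $ i)) ` S)"


section \<open>Forms and general points\<close>

text \<open>
  A polynomial in the variables \<open>x\<^sub>i\<close> with \<open>i :: 'n\<close>: a finitely supported map from exponent
  vectors to coefficients.
\<close>

type_synonym ('n, 'a) mpoly = "('n \<Rightarrow>\<^sub>0 nat) \<Rightarrow>\<^sub>0 'a"

definition form :: "nat \<Rightarrow> ('n::finite, 'a::field) mpoly \<Rightarrow> bool"
  where "form d F \<longleftrightarrow>
    (\<forall>m\<in>Poly_Mapping.keys F. (\<Sum>i\<in>UNIV. Poly_Mapping.lookup m i) = d)"

definition eval_at :: "('n::finite, 'a::field) mpoly \<Rightarrow> 'a ^ 'n \<Rightarrow> 'a"
  where "eval_at F v =
    (\<Sum>m\<in>Poly_Mapping.keys F. Poly_Mapping.lookup F m *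
      (\<Prod>i\<in>UNIV. (v $ i) ^ Poly_Mapping.lookup m i))"

text \<open>The formal partial derivative with respect to \<open>x\<^sub>j\<close>, evaluated at \<open>v\<close>.\<close>

definition partial_at :: "'n \<Rightarrow> ('n::finite, 'a::field) mpoly \<Rightarrow> 'a ^ 'n \<Rightarrow> 'a"
  where "partial_at j F v =
    (\<Sum>m\<in>Poly_Mapping.keys F. Poly_Mapping.lookup F m *
      (of_nat (Poly_Mapping.lookup m j) * (v $ j) ^ (Poly_Mapping.lookup m j - 1) *
       (\<Prod>i\<in>UNIV - {j}. (v $ i) ^ Poly_Mapping.lookup m i)))"

definition differential_at :: "('n::finite, 'a::field) mpoly \<Rightarrow> 'a ^ 'n \<Rightarrow> 'a ^ 'n \<Rightarrow> 'a"
  where "differential_at F v w = (\<Sum>j\<in>UNIV. partial_at j F v * w $ j)"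

definition vanishes_at :: "('n::finite, 'a::field) mpoly \<Rightarrow> ('a ^ 'n) set \<Rightarrow> bool"
  where "vanishes_at F p \<longleftrightarrow> (\<forall>v\<in>p. eval_at F v = 0)"

definition zariski_closed :: "('a::field ^ 'n::finite) set set \<Rightarrow> bool"
  where "zariski_closed V \<longleftrightarrow>
    (\<exists>S. (\<forall>F\<in>S. \<exists>d. form d F) \<and> V = {p. proj_point p \<and> (\<forall>F\<in>S. vanishes_at F p)})"

definition for_general_point :: "(('a::field ^ 'n::finite) set \<Rightarrow> bool) \<Rightarrow> bool"
  where "for_general_point Q \<longleftrightarrow>
    (\<exists>V. zariski_closed V \<and> V \<noteq> {p. proj_point p} \<and>
      (\<forall>p. proj_point p \<and> p \<notin> V \<longrightarrow> Q p))"


section \<open>Plane curves and transverse intersections\<close>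

text \<open>
  These notions are used over algebraically closed fields only. A curve of degree \<open>d\<close> in a plane
  \<open>H\<close> is given by (the restriction to \<open>H\<close> of) a form of degree \<open>d\<close> on the ambient space that does
  not vanish identically on \<open>H\<close>; every form on \<open>H\<close> is such a restriction.
\<close>

definition plane_curve :: "('a::field ^ 'n::finite) set \<Rightarrow> nat \<Rightarrow> ('n, 'a) mpoly \<Rightarrow> bool"
  where "plane_curve H d F \<longleftrightarrow> form d F \<and> (\<exists>v\<in>H. eval_at F v \<noteq> 0)"

definition curve_points ::
    "('a::field ^ 'n::finite) set \<Rightarrow> ('n, 'a) mpoly \<Rightarrow> ('a ^ 'n) set set"
  where "curve_points H F = {p \<in> points_on H. vanishes_at F p}"

text \<open>
  The projective tangent space at \<open>p\<close> of the curve cut out by \<open>F\<close> on \<open>H\<close>. It is a line iff the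
  curve is smooth at \<open>p\<close>, and all of \<open>H\<close> otherwise.
\<close>

definition tangent_space ::
    "('a::field ^ 'n::finite) set \<Rightarrow> ('n, 'a) mpoly \<Rightarrow> ('a ^ 'n) set \<Rightarrow> ('a ^ 'n) set"
  where "tangent_space H F p = {w \<in> H. \<forall>v\<in>p. differential_at F v w = 0}"

definition transverse_at ::
    "('a::field ^ 'n::finite) set \<Rightarrow> ('n, 'a) mpoly \<Rightarrow> ('n, 'a) mpoly \<Rightarrow> ('a ^ 'n) set \<Rightarrow> bool"
  where "transverse_at H F G p \<longleftrightarrow>
    proj_line (tangent_space H F p) \<and> proj_line (tangent_space H G p) \<and>
    tangent_space H F p \<noteq> tangent_space H G p"

definition transverse_intersection ::
    "('a::field ^ 'n::finite) set \<Rightarrow> nat \<Rightarrow> ('n, 'a) mpoly \<Rightarrow> nat \<Rightarrow> ('n, 'a) mpoly \<Rightarrow>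
      ('a ^ 'n) set set \<Rightarrow> bool"
  where "transverse_intersection H a F b G Y \<longleftrightarrow>
    plane_curve H a F \<and> plane_curve H b G \<and>
    Y = curve_points H F \<inter> curve_points H G \<and>
    (\<forall>p\<in>Y. transverse_at H F G p) \<and>
    finite Y \<and> card Y = a * b"


section \<open>Geproci sets and grids\<close>

text \<open>The image in the plane \<open>H\<close> of a point or line \<open>A\<close> under projection from the point \<open>P\<close>.\<close>

definition project :: "('a::field ^ 'n) set \<Rightarrow> ('a ^ 'n) set \<Rightarrow> ('a ^ 'n) set \<Rightarrow> ('a ^ 'n) set"
  where "project P H A = vec.span (P \<union> A) \<inter> H"

definition geproci :: "nat \<Rightarrow> nat \<Rightarrow> ('a::alg_closed_field ^ 4) set set \<Rightarrow> bool"
  where "geproci a b Z \<longleftrightarrow>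
    (\<forall>p\<in>Z. proj_point p) \<and> finite Z \<and> card Z = a * b \<and>
    for_general_point (\<lambda>P. \<forall>H. proj_plane H \<and> \<not> P \<subseteq> H \<longrightarrow>
      (\<exists>F G. transverse_intersection H a F b G (project P H ` Z)))"

text \<open>
  The asymmetric notion, written with square brackets \<open>[a, b]\<close>. The curve defined by \<open>G\<close> has
  degree \<open>b\<close> and its support is the union of the \<open>b\<close> lines \<open>project P H L\<close>, which are distinct for
  general \<open>P\<close>; hence \<open>G\<close> defines that union as a reduced curve.
\<close>

definition bracket_geproci :: "nat \<Rightarrow> nat \<Rightarrow> ('a::alg_closed_field ^ 4) set set \<Rightarrow> bool"
  where "bracket_geproci a b Z \<longleftrightarrow>
    geproci a b Z \<and>
    (\<exists>\<L>. skew_lines \<L> \<and> card \<L> = b \<and>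
      (\<forall>p\<in>Z. \<exists>L\<in>\<L>. p \<subseteq> L) \<and> (\<forall>L\<in>\<L>. card (Z \<inter> points_on L) = a) \<and>
      for_general_point (\<lambda>P. \<forall>H. proj_plane H \<and> \<not> P \<subseteq> H \<longrightarrow>
        (\<exists>F G. transverse_intersection H a F b G (project P H ` Z) \<and>
          curve_points H G = (\<Union>L\<in>\<L>. points_on (project P H L)))))"

definition grid :: "nat \<Rightarrow> nat \<Rightarrow> ('a::field ^ 4) set set \<Rightarrow> bool"
  where "grid a b Z \<longleftrightarrow>
    (\<exists>\<A> \<B>. skew_lines \<A> \<and> card \<A> = a \<and> skew_lines \<B> \<and> card \<B> = b \<and>
      (\<forall>A\<in>\<A>. \<forall>B\<in>\<B>. \<exists>!p. p \<in> points_on A \<inter> points_on B) \<and>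
      Z = (\<Union>A\<in>\<A>. points_on A) \<inter> (\<Union>B\<in>\<B>. points_on B))"


section \<open>The groupoid of a set of skew lines\<close>

text \<open>
  Maps between lines are extensional functions on the points of their source. For pairwise distinct
  lines \<open>L\<close>, \<open>M\<close>, \<open>N\<close> of a set of skew lines in projective 3-space, \<open>line_map L M N\<close> is the map
  from \<open>L\<close> to \<open>M\<close> given by the planes containing \<open>N\<close>.
\<close>

definition line_map :: "('a::field ^ 4) set \<Rightarrow> ('a ^ 4) set \<Rightarrow> ('a ^ 4) set \<Rightarrow>
    ('a ^ 4) set \<Rightarrow> ('a ^ 4) set"
  where "line_map L M N = (\<lambda>p\<in>points_on L. vec.span (p \<union> N) \<inter> M)"

inductive groupoid_arrow ::
    "('a::field ^ 4) set set \<Rightarrow> ('a ^ 4) set \<Rightarrow> ('a ^ 4) set \<Rightarrow>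
      (('a ^ 4) set \<Rightarrow> ('a ^ 4) set) \<Rightarrow> bool"
  for \<L>
  where
    identity: "L \<in> \<L> \<Longrightarrow> groupoid_arrow \<L> L L (\<lambda>p\<in>points_on L. p)"
  | generator: "L \<in> \<L> \<Longrightarrow> M \<in> \<L> \<Longrightarrow> N \<in> \<L> \<Longrightarrow> L \<noteq> M \<Longrightarrow> L \<noteq> N \<Longrightarrow> M \<noteq> N \<Longrightarrow>
      groupoid_arrow \<L> L M (line_map L M N)"
  | composition: "groupoid_arrow \<L> L M f \<Longrightarrow> groupoid_arrow \<L> M N g \<Longrightarrow>
      groupoid_arrow \<L> L N (compose (points_on L) g f)"

text \<open>The group of arrows from \<open>L\<close> to itself.\<close>

definition groupoid_group ::
    "('a::field ^ 4) set set \<Rightarrow> ('a ^ 4) set \<Rightarrow> (('a ^ 4) set \<Rightarrow> ('a ^ 4) set) monoid"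
  where "groupoid_group \<L> L =
    \<lparr>carrier = {f. groupoid_arrow \<L> L L f},
     monoid.mult = (\<lambda>g f. compose (points_on L) g f),
     one = (\<lambda>p\<in>points_on L. p)\<rparr>"

end

theory Submission
  imports Defs
begin

text \<open>
  The groupoid is trivial iff all the lines \<open>L\<^sub>i\<close> lie in one ruling of a smooth quadric: then the
  maps \<open>f\<^sub>i\<^sub>j\<^sub>k\<close> follow the opposite ruling, and conversely \<open>f\<^sub>j\<^sub>i\<^sub>l \<circ> f\<^sub>i\<^sub>j\<^sub>k = id\<close> makes the line through
  \<open>p\<close> and \<open>f\<^sub>i\<^sub>j\<^sub>k p\<close> a transversal of all the lines. If \<open>Z\<close> is a grid, its two families provide the
  quadric. The substantial step is that, when the \<open>L\<^sub>i\<close> lie in one ruling, a geproci set \<open>Z\<close> has the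
  same coordinates \<open>u\<close> on each of them.

  Identify each \<open>L\<^sub>i\<close> with the projective line by means of the opposite ruling, and let \<open>g\<^sub>i\<close> be the
  binary form of degree \<open>a\<close> whose roots are the points of \<open>Z\<close> on \<open>L\<^sub>i\<close>. A plane curve of degree \<open>a\<close>
  through the projection of \<open>Z\<close> from \<open>P\<close> restricts to \<open>c\<^sub>i g\<^sub>i\<close> on the image of \<open>L\<^sub>i\<close>. The images of
  \<open>L\<^sub>i\<close> and \<open>L\<^sub>k\<close> meet in a point with coordinates \<open>w\<^sub>k\<close> and \<open>w\<^sub>i\<close>, where \<open>w\<^sub>i\<close> is the projection of \<open>P\<close>
  from \<open>L\<^sub>i\<close>; hence \<open>c\<^sub>i g\<^sub>i(w\<^sub>k) = c\<^sub>k g\<^sub>k(w\<^sub>i)\<close>. Multiplying these equations around three lines, the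
  constants cancel and leave
  \<open>g\<^sub>i(w\<^sub>k) g\<^sub>k(w\<^sub>l) g\<^sub>l(w\<^sub>i) = g\<^sub>k(w\<^sub>i) g\<^sub>l(w\<^sub>k) g\<^sub>i(w\<^sub>l)\<close>. This holds for general \<open>P\<close>, so it is a
  polynomial identity in \<open>P\<close>. Choosing \<open>P\<close> such that \<open>w\<^sub>k\<close> is a root of \<open>g\<^sub>i\<close> and \<open>w\<^sub>i\<close> is general
  shows that \<open>w\<^sub>k\<close> is a root of \<open>g\<^sub>l\<close> as well.
\<close>

section \<open>Functions that are polynomial along lines\<close>

text \<open>Polynomial functions of degree at most \<open>n\<close> enter only through their
  restrictions to affine lines: the arguments below restrict to a well-chosen line and count roots
  of a one-variable polynomial.\<close>

definition polyfun :: "nat \<Rightarrow> ('a::field ^ 'n \<Rightarrow> 'a) \<Rightarrow> bool"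
  where "polyfun n h \<longleftrightarrow> (\<forall>v w. \<exists>q. degree q \<le> n \<and> (\<forall>t. h (v + t *s w) = poly q t))"

lemma polyfunE:
  assumes "polyfun n h"
  obtains q where "degree q \<le> n" "\<And>t. h (v + t *s w) = poly q t"
  using assms unfolding polyfun_def by blast

lemma polyfun_const: "polyfun n (\<lambda>v. c)"
  unfolding polyfun_def
proof (intro allI exI[of _ "[:c:]"])
qed simp

lemma polyfun_component: "polyfun 1 (\<lambda>v :: 'a::field ^ 'n. v $ i)"
  unfolding polyfun_def
proof (intro allI)
  fix v w :: "'a ^ 'n"
  show "\<exists>q. degree q \<le> 1 \<and> (\<forall>t. (v + t *s w) $ i = poly q t)"
    by (intro exI[of _ "[:v $ i, w $ i:]"]) simp
qed

lemma polyfun_mult: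
  assumes "polyfun m f" "polyfun n g"
  shows "polyfun (m + n) (\<lambda>v. f v * g v)"
  unfolding polyfun_def
proof (intro allI)
  fix v w :: "'a ^ 'b"
  obtain p q where "degree p \<le> m" "\<And>t. f (v + t *s w) = poly p t"
    and "degree q \<le> n" "\<And>t. g (v + t *s w) = poly q t"
    using polyfunE[OF assms(1)] polyfunE[OF assms(2)] by metis
  then show "\<exists>q. degree q \<le> m + n \<and> (\<forall>t. f (v + t *s w) * g (v + t *s w) = poly q t)"
    by (intro exI[of _ "p * q"]) (use degree_mult_le[of p q] in auto)
qed

lemma polyfun_add:
  assumes "polyfun n f" "polyfun n g"
  shows "polyfun n (\<lambda>v. f v + g v)"
  unfolding polyfun_def
proof (intro allI)
  fix v w :: "'a ^ 'b"
  obtain p q where "degree p \<le> n" "\<And>t. f (v + t *s w) = poly p t"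
    and "degree q \<le> n" "\<And>t. g (v + t *s w) = poly q t"
    using polyfunE[OF assms(1)] polyfunE[OF assms(2)] by metis
  then show "\<exists>q. degree q \<le> n \<and> (\<forall>t. f (v + t *s w) + g (v + t *s w) = poly q t)"
    by (intro exI[of _ "p + q"]) (auto intro: degree_add_le)
qed

lemma polyfun_cmult: "polyfun n f \<Longrightarrow> polyfun n (\<lambda>v. c * f v)"
  using polyfun_mult[OF polyfun_const[of 0 c]] by simp

lemma polyfun_diff:
  assumes "polyfun n f" "polyfun n g"
  shows "polyfun n (\<lambda>v. f v - g v)"
  using polyfun_add[OF assms(1) polyfun_cmult[OF assms(2), of "-1"]] by simp

lemma polyfun_sum:
  assumes "\<And>i. i \<in> S \<Longrightarrow> polyfun n (f i)"
  shows "polyfun n (\<lambda>v. \<Sum>i\<in>S. f i v)"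
  using assms
  by (induction S rule: infinite_finite_induct) (auto intro: polyfun_const polyfun_add)

lemma polyfun_prod:
  assumes "\<And>i. i \<in> S \<Longrightarrow> polyfun (d i) (f i)"
  shows "polyfun (\<Sum>i\<in>S. d i) (\<lambda>v. \<Prod>i\<in>S. f i v)"
  using assms
  by (induction S rule: infinite_finite_induct) (auto intro: polyfun_const polyfun_mult)

lemma polyfun_power: "polyfun n f \<Longrightarrow> polyfun (k * n) (\<lambda>v. f v ^ k)"
  using polyfun_prod[of "{..<k}" "\<lambda>_. n" "\<lambda>_. f"] by simp

text \<open>Here \<open>g\<close> acts as the linear part of the affine substitution
  \<open>f\<close>, which carries parametrised lines to parametrised lines.\<close>

lemma polyfun_compose:
  assumes "polyfun n h" and "\<And>v w t. f (v + t *s w) = f v + t *s g w"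
  shows "polyfun n (\<lambda>v. h (f v))"
  using assms unfolding polyfun_def by simp

text \<open>On the line from \<open>v\<close> to \<open>w\<close> both factors restrict to nonzero
  polynomials, as the parameters 0 and 1 show; over an infinite field their product has a non-root.
  This is how several conditions of general position are met at once.\<close>

lemma polyfun_nonzero_mult:
  fixes f g :: "'a::field ^ 'n \<Rightarrow> 'a"
  assumes "infinite (UNIV :: 'a set)" "polyfun m f" "polyfun n g" "f v \<noteq> 0" "g w \<noteq> 0"
  shows "\<exists>x. f x * g x \<noteq> 0"
proof -
  obtain p q where p: "\<And>t. f (v + t *s (w - v)) = poly p t"
    and q: "\<And>t. g (v + t *s (w - v)) = poly q t"
    using polyfunE[OF assms(2)] polyfunE[OF assms(3)] by metis
  have "p \<noteq> 0" using p[of 0] assms(4) by auto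
  moreover have "q \<noteq> 0" using q[of 1] assms(5) by auto
  ultimately have "finite {t. poly (p * q) t = 0}"
    by (simp add: poly_roots_finite)
  then obtain t where "poly (p * q) t \<noteq> 0"
    using assms(1) by (metis (mono_tags, lifting) UNIV_eq_I mem_Collect_eq)
  then show ?thesis using p q by (metis poly_mult)
qed

lemma polyfun_nonzero_prod:
  fixes f :: "'i \<Rightarrow> 'a::field ^ 'n \<Rightarrow> 'a"
  assumes "infinite (UNIV :: 'a set)" "finite S"
    and "\<And>i. i \<in> S \<Longrightarrow> polyfun (d i) (f i)" "\<And>i. i \<in> S \<Longrightarrow> \<exists>v. f i v \<noteq> 0"
  shows "\<exists>v. (\<Prod>i\<in>S. f i v) \<noteq> 0"
  using assms(2-)
proof (induction S)
  case (insert i S)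
  obtain v where "f i v \<noteq> 0" using insert.prems by blast
  moreover obtain w where "(\<Prod>i\<in>S. f i w) \<noteq> 0" using insert by auto
  ultimately have "\<exists>x. f i x * (\<Prod>i\<in>S. f i x) \<noteq> 0"
    by (intro polyfun_nonzero_mult[OF assms(1), of "d i" _ "sum d S"] polyfun_prod)
       (use insert.prems in auto)
  then show ?case using insert.hyps by simp
qed simp

text \<open>Over a finite field, 1 plus the product of all x - c is nonconstant but takes only the
  value 1, so it has no root.\<close>

lemma infinite_alg_closed: "infinite (UNIV :: 'a::alg_closed_field set)"
proof
  assume fin: "finite (UNIV :: 'a set)"
  define p :: "'a poly" where "p = 1 + (\<Prod>c\<in>UNIV. [:-c, 1:])"
  have "degree (\<Prod>c\<in>(UNIV::'a set). [:-c, 1:]) = card (UNIV :: 'a set)"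
    by (subst degree_prod_eq_sum_degree) auto
  moreover have "card (UNIV :: 'a set) > 0" using fin by (simp add: finite_UNIV_card_ge_0)
  ultimately have "degree p > 0" unfolding p_def
    by (subst degree_add_eq_right) auto
  then obtain x where "poly p x = 0" using alg_closed_imp_poly_has_root by blast
  moreover have "poly p x = 1"
    using fin by (auto simp: p_def poly_prod prod_zero_iff)
  ultimately show False by simp
qed

section \<open>Forms as homogeneous polynomial functions\<close>

lemma polyfun_eval_at:
  fixes F :: "('n::finite, 'a::field) mpoly"
  assumes "form d F"
  shows "polyfun d (eval_at F)"
  unfolding eval_at_def
proof (intro polyfun_sum polyfun_cmult)
  fix m assume "m \<in> Poly_Mapping.keys F"
  then have "(\<Sum>i\<in>UNIV. Poly_Mapping.lookup m i) = d" using assms by (simp add: form_def)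
  moreover have "polyfun (\<Sum>i\<in>UNIV. Poly_Mapping.lookup m i)
      (\<lambda>v :: 'a ^ 'n. \<Prod>i\<in>UNIV. v $ i ^ Poly_Mapping.lookup m i)"
    using polyfun_power[OF polyfun_component] by (intro polyfun_prod) fastforce
  ultimately show "polyfun d (\<lambda>v :: 'a ^ 'n. \<Prod>i\<in>UNIV. v $ i ^ Poly_Mapping.lookup m i)"
    by simp
qed

lemma eval_at_scale:
  assumes "form d F"
  shows "eval_at F (c *s v) = c ^ d * eval_at F v"
proof -
  have "(\<Prod>i\<in>UNIV. ((c *s v) $ i) ^ Poly_Mapping.lookup m i) =
      c ^ d * (\<Prod>i\<in>UNIV. (v $ i) ^ Poly_Mapping.lookup m i)"
    if "m \<in> Poly_Mapping.keys F" for m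
    using that assms
    by (simp add: form_def power_mult_distrib prod.distrib flip: power_sum)
  then show ?thesis
    by (simp add: eval_at_def sum_distrib_left mult_ac)
qed

section \<open>Binary forms\<close>

text \<open>Points of the projective line are handled through nonzero coordinate vectors; two of
  these give the same point iff \<open>det2\<close> vanishes on them.\<close>

definition det2 :: "'a::field ^ 2 \<Rightarrow> 'a ^ 2 \<Rightarrow> 'a"
  where "det2 x y = x $ 1 * y $ 2 - x $ 2 * y $ 1"

lemma det2_simps [simp]:
  "det2 x x = 0" "det2 0 x = 0" "det2 x 0 = 0"
  "det2 (x + x') y = det2 x y + det2 x' y" "det2 y (x + x') = det2 y x + det2 y x'"
  "det2 (x - x') y = det2 x y - det2 x' y" "det2 y (x - x') = det2 y x - det2 y x'"
  "det2 (c *s x) y = c * det2 x y" "det2 y (c *s x) = c * det2 y x"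
  by (simp_all add: det2_def algebra_simps)

lemma det2_swap: "det2 x y = - det2 y x"
  by (simp add: det2_def)

lemma vec2_eq_iff: "(x :: 'a ^ 2) = y \<longleftrightarrow> x $ 1 = y $ 1 \<and> x $ 2 = y $ 2"
  by (simp add: vec_eq_iff forall_2)

lemma cramer2: "det2 x y *s z = det2 z y *s x + det2 x z *s y"
  by (simp add: vec2_eq_iff det2_def algebra_simps)

lemma det2_eq_0_iff:
  assumes "y \<noteq> 0"
  shows "det2 x y = 0 \<longleftrightarrow> (\<exists>c. x = c *s y)"
proof
  assume *: "det2 x y = 0"
  show "\<exists>c. x = c *s y"
  proof (cases "y $ 1 = 0")
    case True
    then have "y $ 2 \<noteq> 0" using assms by (auto simp: vec2_eq_iff)
    then show ?thesis using * True
      by (intro exI[of _ "x $ 2 / y $ 2"]) (auto simp: vec2_eq_iff det2_def)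
  next
    case False
    then show ?thesis using *
      by (intro exI[of _ "x $ 1 / y $ 1"]) (auto simp: vec2_eq_iff det2_def field_simps)
  qed
qed auto

lemma ex_det2_nonzero: "x \<noteq> 0 \<Longrightarrow> \<exists>y. det2 x y \<noteq> 0"
proof -
  assume "x \<noteq> 0"
  then have "det2 x (vector [0, 1]) \<noteq> 0 \<or> det2 x (vector [1, 0]) \<noteq> 0"
    by (auto simp: det2_def vec2_eq_iff)
  then show ?thesis by blast
qed

lemma polyfun_det2_left: "polyfun 1 (\<lambda>x. det2 x u)"
  unfolding det2_def
  using polyfun_diff[OF polyfun_cmult[OF polyfun_component, of "u $ 2" 1]
      polyfun_cmult[OF polyfun_component, of "u $ 1" 2]]
  by (simp only: mult.commute)

definition pairwise_indep :: "('a::field ^ 2) set \<Rightarrow> bool"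
  where "pairwise_indep U \<longleftrightarrow> (\<forall>u\<in>U. \<forall>v\<in>U. u \<noteq> v \<longrightarrow> det2 u v \<noteq> 0)"

text \<open>Restricted to a line through \<open>x\<close> that crosses the direction of every
  \<open>u\<close> in \<open>U\<close>, the form becomes a polynomial of degree at most
  \<open>n\<close> with more than \<open>n\<close> roots.\<close>

lemma binary_form_eq_0:
  fixes h :: "'a::field ^ 2 \<Rightarrow> 'a"
  assumes inf: "infinite (UNIV :: 'a set)" and h: "polyfun n h" "\<And>c v. h (c *s v) = c ^ n * h v"
    and U: "finite U" "card U > n" "pairwise_indep U" "0 \<notin> U" "\<And>u. u \<in> U \<Longrightarrow> h u = 0"
  shows "h x = 0"
proof (cases "x = 0")
  case True
  obtain u where "u \<in> U" using U by fastforce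
  then show ?thesis using h(2)[of 0 u] U(5) True by simp
next
  case False
  \<comment> \<open>The direction \<open>y\<close> is proportional neither to \<open>x\<close> nor
    to any member of \<open>U\<close>.\<close>
  obtain y where "(\<Prod>u\<in>insert x U. det2 y u) \<noteq> 0"
    using polyfun_nonzero_prod[OF inf, of "insert x U" "\<lambda>_. 1" "\<lambda>u y. det2 y u"]
      ex_det2_nonzero det2_swap polyfun_det2_left U(1,4) False
    by (metis finite.insertI insert_iff neg_equal_0_iff_equal)
  then have y: "det2 y u \<noteq> 0" if "u \<in> insert x U" for u
    using that U(1) by (auto simp: prod_zero_iff)
  obtain q where q: "degree q \<le> n" "\<And>t. h (x + t *s y) = poly q t"
    using polyfunE[OF h(1)] by blast
  \<comment> \<open>The parameter at which \<open>x + t *s y\<close> becomes proportional to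
    \<open>u\<close>.\<close>
  define r where "r u = det2 x u / det2 u y" for u
  have nz: "det2 u y \<noteq> 0" if "u \<in> insert x U" for u
    using y[OF that] det2_swap[of u y] by simp
  have "poly q (r u) = 0" if u: "u \<in> U" for u
  proof -
    have "det2 u y *s (x + r u *s y) = det2 x y *s u"
      using nz[of u] u cramer2[of u y x] det2_swap[of u x]
      by (simp add: r_def vec.scale_right_distrib)
    then have "det2 u y ^ n * h (x + r u *s y) = 0"
      using h(2) U(5)[OF u] by (metis mult_zero_right)
    then show ?thesis using nz[of u] u q(2) by simp
  qed
  moreover have "inj_on r U"
  proof (rule inj_onI, rule ccontr)
    fix u v assume uv: "u \<in> U" "v \<in> U" "r u = r v" "u \<noteq> v"
    then have "det2 x u * det2 v y = det2 x v * det2 u y"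
      using nz[of u] nz[of v] by (simp add: r_def field_simps)
    \<comment> \<open>The Pluecker relation between four vectors of the plane.\<close>
    then have "det2 x y * det2 u v = 0"
      by (simp add: det2_def algebra_simps)
    then show False using uv U(3) nz[of x] by (auto simp: pairwise_indep_def)
  qed
  ultimately have "card U \<le> card {t. poly q t = 0}" if "q \<noteq> 0"
    using that by (metis (mono_tags, lifting) card_inj_on_le image_subsetI mem_Collect_eq
        poly_roots_finite)
  then have "q = 0" using card_poly_roots_bound[of q] q(1) U(2) by fastforce
  then show ?thesis using q(2)[of 0] by simp
qed

text \<open>With \<open>U\<close> the coordinates of the points of \<open>Z\<close> on one line,
  this is the form \<open>g\<^sub>i\<close> of the overview.\<close>

definition root_form :: "('a::field ^ 2) set \<Rightarrow> 'a ^ 2 \<Rightarrow> 'a"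
  where "root_form U x = (\<Prod>u\<in>U. det2 x u)"

lemma polyfun_root_form: "polyfun (card U) (root_form U)"
  using polyfun_prod[of U "\<lambda>_. 1" "\<lambda>u x. det2 x u", OF polyfun_det2_left]
  by (simp add: root_form_def[abs_def])

lemma root_form_scale: "root_form U (c *s x) = c ^ card U * root_form U x"
  by (simp add: root_form_def prod.distrib)

lemma root_form_eq_0_iff: "finite U \<Longrightarrow> root_form U x = 0 \<longleftrightarrow> (\<exists>u\<in>U. det2 x u = 0)"
  by (auto simp: root_form_def prod_zero_iff)

lemma root_form_nonzero:
  fixes U :: "('a::field ^ 2) set"
  assumes "infinite (UNIV :: 'a set)" "finite U" "0 \<notin> U"
  shows "\<exists>x. root_form U x \<noteq> 0"
  unfolding root_form_def
  using polyfun_nonzero_prod[OF assms(1,2), of "\<lambda>_. 1" "\<lambda>u x. det2 x u"] assms(3)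
    polyfun_det2_left ex_det2_nonzero det2_swap by (metis neg_equal_0_iff_equal)

text \<open>Choose \<open>c\<close> so that both sides agree at some \<open>y\<close> that is not a
  root; their difference then vanishes on \<open>U\<close> and at \<open>y\<close>, one point more
  than the degree allows.\<close>

lemma binary_form_eq_root_form:
  fixes h :: "'a::field ^ 2 \<Rightarrow> 'a"
  assumes inf: "infinite (UNIV :: 'a set)" and h: "polyfun n h" "\<And>c v. h (c *s v) = c ^ n * h v"
    and U: "finite U" "card U = n" "pairwise_indep U" "0 \<notin> U" "\<And>u. u \<in> U \<Longrightarrow> h u = 0"
  shows "\<exists>c. \<forall>x. h x = c * root_form U x"
proof -
  obtain y where y: "root_form U y \<noteq> 0" using root_form_nonzero[OF inf U(1,4)] by blast
  define c where "c = h y / root_form U y"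
  have yU: "det2 y u \<noteq> 0" "det2 u y \<noteq> 0" if "u \<in> U" for u
    using y that U(1) det2_swap[of u y] by (auto simp: root_form_eq_0_iff)
  have "y \<notin> U" using yU(1)[of y] by auto
  have "y \<noteq> 0" if "n > 0" using yU U(2) that by fastforce
  have "h x - c * root_form U x = 0" for x
  \<comment> \<open>In degree 0 the set \<open>U\<close> is empty and \<open>y\<close> may be the
    zero vector, so homogeneity is used instead of the count of roots.\<close>
  proof (cases "n = 0")
    case True
    then show ?thesis using h(2)[of 0 x] h(2)[of 0 y] U(1,2) y
      by (simp add: c_def root_form_def)
  next
    case False
    show ?thesis
    proof (rule binary_form_eq_0[OF inf, of n _ "insert y U"])
      show "polyfun n (\<lambda>x. h x - c * root_form U x)"
        using polyfun_diff polyfun_cmult polyfun_root_form h(1) U(2) by blast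
      show "h u - c * root_form U u = 0" if "u \<in> insert y U" for u
        using that U(1,5) y by (cases "u = y") (auto simp: c_def, auto simp: root_form_eq_0_iff)
      show "pairwise_indep (insert y U)" using U(3) yU by (auto simp: pairwise_indep_def)
    qed (use U h(2) \<open>y \<notin> U\<close> \<open>n > 0 \<Longrightarrow> y \<noteq> 0\<close> False
          in \<open>auto simp: root_form_scale algebra_simps\<close>)
  qed
  then show ?thesis by (intro exI[of _ c]) simp
qed

section \<open>Cones over projected curves\<close>

text \<open>A form invariant under translation by \<open>P\<close> is a form on the quotient by
  \<open>P\<close>; it defines the cone with vertex \<open>P\<close> over a plane curve.\<close>

definition cone :: "'a::field ^ 'n \<Rightarrow> nat \<Rightarrow> ('a ^ 'n \<Rightarrow> 'a) \<Rightarrow> bool"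
  where "cone P n h \<longleftrightarrow> polyfun n h \<and> (\<forall>c v. h (c *s v) = c ^ n * h v) \<and>
    (\<forall>c v. h (v + c *s P) = h v)"

section \<open>Points, their representatives and projection to a plane\<close>

lemma proj_point_span: "v \<noteq> 0 \<Longrightarrow> proj_point (vec.span {v})"
  by (simp add: proj_point_def)

lemma span_singleton_eq_iff:
  assumes "v \<noteq> 0"
  shows "vec.span {v} = vec.span {w} \<longleftrightarrow> (\<exists>c. c \<noteq> 0 \<and> v = c *s w)"
proof
  assume *: "vec.span {v} = vec.span {w}"
  have "v \<in> vec.span {w}" using * vec.span_base[of v "{v}"] by simp
  then obtain c where "v = c *s w" by (auto simp: vec.span_singleton)
  moreover from this have "c \<noteq> 0" using assms by auto
  ultimately show "\<exists>c. c \<noteq> 0 \<and> v = c *s w" by blast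
next
  assume "\<exists>c. c \<noteq> 0 \<and> v = c *s w"
  then obtain c where c: "c \<noteq> 0" "v = c *s w" by blast
  then have "w = inverse c *s v" by (simp add: vec.scale_scale)
  then have "v \<in> vec.span {w}" "w \<in> vec.span {v}"
    using c(2) unfolding vec.span_singleton by blast+
  then show "vec.span {v} = vec.span {w}" by (simp add: vec.span_eq)
qed

lemma proj_pointE:
  assumes "proj_point p"
  obtains v where "v \<noteq> 0" "p = vec.span {v}"
proof -
  obtain B where B: "B \<subseteq> p" "vec.independent B" "p \<subseteq> vec.span B" "card B = vec.dim p"
    using vec.basis_exists by blast
  then obtain v where v: "B = {v}" using assms by (auto simp: proj_point_def card_1_singleton_iff)
  have "vec.span B \<subseteq> p" using B(1) assms by (simp add: proj_point_def vec.span_minimal)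
  then show ?thesis using that[of v] B v by (auto simp: vec.dependent_single)
qed

lemma subspace_scale_iff:
  fixes v :: "'a::field ^ 'n"
  assumes "vec.subspace H" "c \<noteq> 0"
  shows "c *s v \<in> H \<longleftrightarrow> v \<in> H"
proof
  assume "c *s v \<in> H"
  then have "inverse c *s (c *s v) \<in> H" using assms(1) by (rule vec.subspace_scale[rotated])
  then show "v \<in> H" using assms(2) by (simp add: vec.scale_scale)
qed (use assms(1) in \<open>rule vec.subspace_scale\<close>)

text \<open>As \<open>H\<close> and \<open>P\<close> span the whole space, every vector has exactly
  one translate along \<open>P\<close> in \<open>H\<close>. Linearity is stated along parametrised
  lines, the shape that \<open>polyfun_compose\<close> takes.\<close>

lemma plane_projection:
  fixes P :: "'a::field ^ 4"
  assumes "proj_plane H" "\<not> vec.span {P} \<subseteq> H"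
  shows "\<exists>\<pi>. (\<forall>v. \<pi> v \<in> H) \<and> (\<forall>v. \<exists>c. \<pi> v = v + c *s P) \<and>
    (\<forall>v w t. \<pi> (v + t *s w) = \<pi> v + t *s \<pi> w) \<and> (\<forall>v c. \<pi> (v + c *s P) = \<pi> v) \<and>
    (\<forall>v c. \<pi> (c *s v) = c *s \<pi> v)"
proof -
  have H: "vec.subspace H" "vec.dim H = 3" using assms(1) by (auto simp: proj_plane_def)
  have PH: "P \<notin> H" using assms(2) H(1) vec.span_minimal[of "{P}" H] by blast
  have spanH: "vec.span H = H" using H(1) by (simp add: vec.span_eq_iff)
  have "vec.dim (insert P H) = 4" using H(2) PH
    by (simp add: vec.dim_insert spanH)
  then have full: "vec.span (insert P H) = UNIV"
    using vec.dim_eq_full[of "insert P H"] by (simp add: vec.dimension_def card_cart_basis)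
  have "\<exists>c. v + c *s P \<in> H" for v
  proof -
    have "v \<in> vec.span (insert P H)" using full by simp
    then obtain k where "v - k *s P \<in> H"
      by (auto simp: vec.span_breakdown_eq spanH)
    then show ?thesis by (intro exI[of _ "-k"]) simp
  qed
  then obtain \<phi> where \<phi>: "\<And>v. v + \<phi> v *s P \<in> H" by metis
  define \<pi> where "\<pi> v = v + \<phi> v *s P" for v
  have \<pi>H: "\<pi> v \<in> H" for v using \<phi> by (simp add: \<pi>_def)
  \<comment> \<open>Uniqueness of the translate; each linearity clause compares two members of
    \<open>H\<close> that differ by a multiple of \<open>P\<close>.\<close>
  have uniq: "x = y" if "x \<in> H" "y \<in> H" "x - y = c *s P" for x y c
  proof -
    have "c *s P \<in> H" using that vec.subspace_diff[OF H(1)] by metis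
    then have "c = 0" using PH subspace_scale_iff[OF H(1)] by blast
    then show ?thesis using that(3) by simp
  qed
  show ?thesis
  proof (intro exI[of _ \<pi>] conjI allI)
    show "\<pi> v \<in> H" for v by fact
    show "\<exists>c. \<pi> v = v + c *s P" for v by (auto simp: \<pi>_def)
    show "\<pi> (v + t *s w) = \<pi> v + t *s \<pi> w" for v w t
      by (rule uniq[OF \<pi>H vec.subspace_add[OF H(1) \<pi>H vec.subspace_scale[OF H(1) \<pi>H]],
            of _ _ _ _ "\<phi> (v + t *s w) - \<phi> v - t * \<phi> w"])
         (simp add: \<pi>_def vec_eq_iff algebra_simps)
    show "\<pi> (v + c *s P) = \<pi> v" for v c
      by (rule uniq[OF \<pi>H \<pi>H, of _ _ "\<phi> (v + c *s P) + c - \<phi> v"])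
         (simp add: \<pi>_def vec_eq_iff algebra_simps)
    show "\<pi> (c *s v) = c *s \<pi> v" for v c
      by (rule uniq[OF \<pi>H vec.subspace_scale[OF H(1) \<pi>H],
            of _ _ _ "\<phi> (c *s v) - c * \<phi> v"])
         (simp add: \<pi>_def vec_eq_iff algebra_simps)
  qed
qed

lemma exists_complementary_plane:
  fixes P :: "'a::field ^ 4"
  assumes "P \<noteq> 0"
  obtains H where "proj_plane H" "\<not> vec.span {P} \<subseteq> H"
proof -
  obtain i where i: "P $ i \<noteq> 0" using assms by (auto simp: vec_eq_iff)
  define H where "H = {x :: 'a ^ 4. \<forall>j. j \<notin> - {i} \<longrightarrow> x $ j = 0}"
  have "vec.dim H = card (- {i})" unfolding H_def by (rule dim_substandard_cart)
  also have "\<dots> = 3" by (simp add: Compl_eq_Diff_UNIV)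
  finally have "proj_plane H"
    by (auto simp: proj_plane_def H_def vec.subspace_def)
  moreover have "P \<notin> H" using i by (simp add: H_def)
  ultimately show ?thesis using that vec.span_base[of P "{P}"] by blast
qed

text \<open>
  Composing the two curves in the definition of geproci with a linear projection from the point
  spanned by \<open>P\<close> turns them into cones; only the finiteness of the intersection, and not its
  transversality, is retained.
\<close>

lemma geproci_cones:
  fixes Z :: "('a::alg_closed_field ^ 4) set set"
  assumes "geproci a b Z"
  shows "\<exists>r N. polyfun r N \<and> (\<exists>v. N v \<noteq> 0) \<and>
    (\<forall>P. N P \<noteq> 0 \<longrightarrow> P \<noteq> 0 \<longrightarrow> (\<exists>f g. cone P a f \<and> cone P b g \<and> (\<exists>v. f v \<noteq> 0) \<and>
      (\<forall>p\<in>Z. \<forall>v\<in>p. f v = 0 \<and> g v = 0) \<and>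
      (\<forall>u v. (\<forall>c d e. c *s u + d *s v = e *s P \<longrightarrow> c = 0 \<and> d = 0) \<longrightarrow>
        (\<exists>t. f (u + t *s v) \<noteq> 0 \<or> g (u + t *s v) \<noteq> 0))))"
proof -
  obtain V where V: "zariski_closed V" "V \<noteq> {p. proj_point p}"
    "\<And>P H. proj_point P \<Longrightarrow> P \<notin> V \<Longrightarrow> proj_plane H \<Longrightarrow> \<not> P \<subseteq> H \<Longrightarrow>
      \<exists>F G. transverse_intersection H a F b G (project P H ` Z)"
    using assms unfolding geproci_def for_general_point_def by blast
  then obtain S where S: "\<forall>F\<in>S. \<exists>d. form d F"
    "V = {p. proj_point p \<and> (\<forall>F\<in>S. vanishes_at F p)}"
    unfolding zariski_closed_def by blast
  then obtain q where q: "proj_point q" "q \<notin> V" using V(2) by blast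
  \<comment> \<open>One equation of the exceptional locus that fails somewhere serves as
    \<open>N\<close>: wherever it is nonzero, the centre of projection is general.\<close>
  then obtain R where R: "R \<in> S" "\<not> vanishes_at R q" using S(2) by blast
  then obtain r where r: "form r R" using S(1) by blast
  show ?thesis
  proof (rule exI[of _ r], rule exI[of _ "eval_at R"], intro conjI allI impI)
    show "polyfun r (eval_at R)" using r by (rule polyfun_eval_at)
    show "\<exists>v. eval_at R v \<noteq> 0" using R(2) by (auto simp: vanishes_at_def)
    fix P :: "'a ^ 4" assume P: "eval_at R P \<noteq> 0" "P \<noteq> 0"
    obtain H where H: "proj_plane H" "\<not> vec.span {P} \<subseteq> H"
      using exists_complementary_plane[OF P(2)] .
    have "vec.span {P} \<notin> V" using S(2) R(1) P(1) vec.span_base[of P "{P}"]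
      by (auto simp: vanishes_at_def)
    then obtain F G where FG: "transverse_intersection H a F b G (project (vec.span {P}) H ` Z)"
      using V(3)[OF proj_point_span[OF P(2)] _ H] by blast
    obtain \<pi> where \<pi>: "\<And>v. \<pi> v \<in> H" "\<And>v. \<exists>c. \<pi> v = v + c *s P"
      "\<And>v w t. \<pi> (v + t *s w) = \<pi> v + t *s \<pi> w" "\<And>v c. \<pi> (v + c *s P) = \<pi> v"
      "\<And>v c. \<pi> (c *s v) = c *s \<pi> v"
      using plane_projection[OF H] by blast
    define f where "f v = eval_at F (\<pi> v)" for v
    define g where "g v = eval_at G (\<pi> v)" for v
    have F: "form a F" "form b G" "\<exists>v\<in>H. eval_at F v \<noteq> 0"
      using FG by (auto simp: transverse_intersection_def plane_curve_def)
    have "cone P n (\<lambda>v. eval_at F (\<pi> v))" if "form n F" for n F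
      unfolding cone_def using polyfun_compose[OF polyfun_eval_at[OF that], of \<pi> \<pi>, OF \<pi>(3)]
      by (intro conjI allI) (simp_all only: \<pi>(4,5) eval_at_scale[OF that])
    then have "cone P a f" "cone P b g"
      using F(1,2) by (simp_all add: f_def[abs_def] g_def[abs_def])
    moreover have "\<exists>v. f v \<noteq> 0"
    proof -
      \<comment> \<open>Since \<open>P\<close> lies outside \<open>H\<close>, the projection
        \<open>\<pi>\<close> fixes \<open>H\<close>; so \<open>f\<close> agrees there with
        \<open>F\<close>, which does not vanish identically on \<open>H\<close>.\<close>
      obtain v where v: "v \<in> H" "eval_at F v \<noteq> 0" using F(3) by blast
      obtain c where c: "\<pi> v = v + c *s P" using \<pi>(2) by blast
      have "c *s P \<in> H" using vec.subspace_diff[of H "\<pi> v" v] \<pi>(1)[of v] v(1) H(1) c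
        by (simp add: proj_plane_def)
      moreover have "P \<notin> H" using H vec.span_minimal[of "{P}" H]
        unfolding proj_plane_def by blast
      ultimately have "c = 0" using H(1) subspace_scale_iff[of H c P]
        unfolding proj_plane_def by blast
      then have "f v \<noteq> 0" using v(2) c by (simp add: f_def)
      then show ?thesis by blast
    qed
    moreover have "f v = 0 \<and> g v = 0" if "p \<in> Z" "v \<in> p" for p v
    proof -
      obtain c where "\<pi> v = v + c *s P" using \<pi>(2) by blast
      moreover have "v \<in> vec.span (vec.span {P} \<union> p)" "P \<in> vec.span (vec.span {P} \<union> p)"
        using that(2) by (simp_all add: vec.span_base)
      ultimately have "\<pi> v \<in> project (vec.span {P}) H p"
        using \<pi>(1)[of v] by (simp add: project_def vec.span_add vec.span_scale)
      moreover have "project (vec.span {P}) H p \<in> curve_points H F \<inter> curve_points H G"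
        using FG that(1) by (auto simp: transverse_intersection_def)
      ultimately show ?thesis by (auto simp: curve_points_def vanishes_at_def f_def g_def)
    qed
    \<comment> \<open>If both cones vanished along this line, its projection would give infinitely
      many points of a finite intersection. By \<open>indep\<close>, the vectors \<open>u\<close>
      and \<open>v\<close> stay independent modulo \<open>P\<close>, so these points are nonzero and
      distinct.\<close>
    moreover have "\<exists>t. f (u + t *s v) \<noteq> 0 \<or> g (u + t *s v) \<noteq> 0"
      if indep: "\<And>c d e. c *s u + d *s v = e *s P \<Longrightarrow> c = 0 \<and> d = 0" for u v
    proof (rule ccontr)
      assume "\<nexists>t. f (u + t *s v) \<noteq> 0 \<or> g (u + t *s v) \<noteq> 0"
      then have zero: "eval_at F (\<pi> (u + t *s v)) = 0" "eval_at G (\<pi> (u + t *s v)) = 0" for t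
        by (auto simp: f_def g_def)
      have nz: "\<pi> (u + t *s v) \<noteq> 0" for t
      proof
        assume *: "\<pi> (u + t *s v) = 0"
        obtain c where "\<pi> (u + t *s v) = u + t *s v + c *s P" using \<pi>(2) by blast
        then have "1 *s u + t *s v = (- c) *s P" using *
          by (simp add: add_eq_0_iff2)
        then show False using indep by fastforce
      qed
      have "vec.span {\<pi> (u + t *s v)} \<in> curve_points H F \<inter> curve_points H G" for t
        using proj_point_span[OF nz[of t]] \<pi>(1)[of "u + t *s v"] H(1) zero[of t] F(1,2)
        by (auto simp: curve_points_def points_on_def vanishes_at_def vec.span_singleton
            eval_at_scale proj_plane_def vec.subspace_scale)
      then have "range (\<lambda>t. vec.span {\<pi> (u + t *s v)}) \<subseteq> project (vec.span {P}) H ` Z"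
        using FG by (auto simp: transverse_intersection_def)
      moreover have "finite (project (vec.span {P}) H ` Z)"
        using FG unfolding transverse_intersection_def by blast
      moreover have "inj (\<lambda>t. vec.span {\<pi> (u + t *s v)})"
      proof (rule injI)
        fix s t assume "vec.span {\<pi> (u + s *s v)} = vec.span {\<pi> (u + t *s v)}"
        then obtain c where c: "\<pi> (u + s *s v) = c *s \<pi> (u + t *s v)"
          using span_singleton_eq_iff[OF nz] by blast
        obtain d e where "\<pi> (u + s *s v) = u + s *s v + d *s P" "\<pi> (u + t *s v) = u + t *s v + e *s P"
          using \<pi>(2) by metis
        then have "(1 - c) *s u + (s - c * t) *s v = (c * e - d) *s P"
          using c by (simp add: vec_eq_iff algebra_simps)
        then show "s = t" using indep by fastforce
      qed
      ultimately show False
        using infinite_alg_closed[where ?'a = 'a] finite_subset finite_imageD by blast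
    qed
    ultimately show "\<exists>f g. cone P a f \<and> cone P b g \<and> (\<exists>v. f v \<noteq> 0) \<and>
      (\<forall>p\<in>Z. \<forall>v\<in>p. f v = 0 \<and> g v = 0) \<and>
      (\<forall>u v. (\<forall>c d e. c *s u + d *s v = e *s P \<longrightarrow> c = 0 \<and> d = 0) \<longrightarrow>
        (\<exists>t. f (u + t *s v) \<noteq> 0 \<or> g (u + t *s v) \<noteq> 0))"
      by blast
  qed
qed

section \<open>Lines in one ruling of a quadric\<close>

definition pt :: "'a::field ^ 4 ^ 4 \<Rightarrow> 'a ^ 2 \<Rightarrow> 'a ^ 2 \<Rightarrow> 'a ^ 4"
  where "pt A \<sigma> x = A *v (\<chi> i. if i = 1 then \<sigma> $ 1 * x $ 1 else if i = 2 then \<sigma> $ 1 * x $ 2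
    else if i = 3 then \<sigma> $ 2 * x $ 1 else \<sigma> $ 2 * x $ 2)"

definition ev :: "'a::field ^ 4 ^ 4 \<Rightarrow> 'a ^ 2 \<Rightarrow> 'a ^ 4 \<Rightarrow> 'a ^ 2"
  where "ev B \<sigma> v = (let c = B *v v in
    vector [\<sigma> $ 2 * c $ 1 - \<sigma> $ 1 * c $ 3, \<sigma> $ 2 * c $ 2 - \<sigma> $ 1 * c $ 4])"

text \<open>
  In the basis given by the columns of \<open>A\<close>, \<open>pt A\<close> is the tensor product parametrising a smooth
  quadric: \<open>pt A \<sigma>\<close> runs through a line of one ruling and \<open>\<lambda>\<sigma>. pt A \<sigma> x\<close> through one of the other.
  The kernel of \<open>ev B \<sigma>\<close> is the line of \<open>\<sigma>\<close>, so \<open>ev B \<sigma>\<close> is the projection from that line.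
\<close>

locale frame =
  fixes A B :: "'a::field ^ 4 ^ 4"
  assumes BA: "B ** A = mat 1"
begin

lemma AB: "A ** B = mat 1"
  using BA by (simp add: matrix_left_right_inverse)

lemma BA_vec [simp]: "B *v (A *v x) = x" and AB_vec: "A *v (B *v x) = x"
  by (simp_all add: matrix_vector_mul_assoc AB BA)

lemma pt_add [simp]: "pt A \<sigma> (x + y) = pt A \<sigma> x + pt A \<sigma> y" "pt A (\<sigma> + \<tau>) x = pt A \<sigma> x + pt A \<tau> x"
  by (simp_all add: pt_def flip: matrix_vector_right_distrib)
     (rule arg_cong[where f = "(*v) A"], simp add: vec_eq_iff algebra_simps)+

lemma pt_scale [simp]: "pt A \<sigma> (c *s x) = c *s pt A \<sigma> x" "pt A (c *s \<sigma>) x = c *s pt A \<sigma> x"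
  by (simp_all add: pt_def flip: vec.scale)
     (rule arg_cong[where f = "(*v) A"], simp add: vec_eq_iff algebra_simps)+

lemma pt_diff [simp]: "pt A (\<sigma> - \<tau>) x = pt A \<sigma> x - pt A \<tau> x"
  using pt_add(2)[of "\<sigma> - \<tau>" \<tau> x] by (simp add: eq_diff_eq)

lemma ev_add [simp]: "ev B \<sigma> (v + w) = ev B \<sigma> v + ev B \<sigma> w"
  by (simp add: ev_def Let_def vec2_eq_iff algebra_simps)

lemma ev_scale [simp]: "ev B \<sigma> (c *s v) = c *s ev B \<sigma> v"
  by (simp add: ev_def Let_def vec2_eq_iff algebra_simps vec.scale)

lemma ev_diff [simp]: "ev B \<sigma> (v - w) = ev B \<sigma> v - ev B \<sigma> w"
  using ev_add[of \<sigma> "v - w" w] by (simp add: eq_diff_eq)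

lemma ev_0 [simp]: "ev B \<sigma> 0 = 0"
  by (simp add: ev_def vec2_eq_iff)

lemma pt_0 [simp]: "pt A \<sigma> 0 = 0" "pt A 0 x = 0"
  using pt_scale(1)[of \<sigma> 0 0] pt_scale(2)[of 0 0 x] by simp_all

lemma ev_pt [simp]: "ev B \<sigma> (pt A \<tau> x) = det2 \<tau> \<sigma> *s x"
  by (simp add: ev_def pt_def Let_def vec2_eq_iff det2_def algebra_simps)

text \<open>The two points differ by a multiple of \<open>v\<close>, so they have the same image
  under projection from \<open>v\<close>: this is where the images of the lines of
  \<open>\<sigma>\<close> and \<open>\<tau>\<close> meet.\<close>

lemma pt_ev: "pt A \<sigma> (ev B \<tau> v) = pt A \<tau> (ev B \<sigma> v) + det2 \<sigma> \<tau> *s v"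
proof -
  define c where "c = B *v v"
  have v: "v = A *v c" by (simp add: c_def AB_vec)
  show ?thesis
    unfolding v pt_def ev_def BA_vec Let_def
    by (simp add: flip: vec.scale vec.add)
       (rule arg_cong[where f = "(*v) A"], simp add: vec_eq_iff forall_4 det2_def algebra_simps)
qed

lemma ev_eq_0:
  assumes "\<sigma> \<noteq> 0" "ev B \<sigma> v = 0"
  obtains x where "v = pt A \<sigma> x"
proof -
  obtain \<tau> where \<tau>: "det2 \<sigma> \<tau> \<noteq> 0" using ex_det2_nonzero assms(1) by blast
  have "v = pt A \<sigma> (inverse (det2 \<sigma> \<tau>) *s ev B \<tau> v)"
    using pt_ev[of \<sigma> \<tau> v] assms(2) \<tau> by (simp add: vec.scale_scale)
  then show ?thesis using that by blast
qed

lemma pt_eq_0_iff: "pt A \<sigma> x = 0 \<longleftrightarrow> \<sigma> = 0 \<or> x = 0"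
proof
  assume *: "pt A \<sigma> x = 0"
  show "\<sigma> = 0 \<or> x = 0"
  proof (rule disjCI)
    assume "x \<noteq> 0"
    show "\<sigma> = 0"
    proof (rule ccontr)
      assume "\<sigma> \<noteq> 0"
      then obtain \<tau> where "det2 \<sigma> \<tau> \<noteq> 0" using ex_det2_nonzero by blast
      then show False using ev_pt[of \<tau> \<sigma> x] * \<open>x \<noteq> 0\<close> by simp
    qed
  qed
qed auto

text \<open>A cone is constant along its vertex, hence takes equal values at the two points over the
  intersection of the projected lines. This is the source of \<open>c\<^sub>i g\<^sub>i(w\<^sub>k) =
  c\<^sub>k g\<^sub>k(w\<^sub>i)\<close>.\<close>

lemma cone_pt_swap:
  assumes "cone P n h"
  shows "h (pt A \<sigma> (ev B \<tau> P)) = h (pt A \<tau> (ev B \<sigma> P))"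
  using assms by (simp add: cone_def pt_ev[of \<sigma> \<tau>])

lemma polyfun_pt: "polyfun n h \<Longrightarrow> polyfun n (\<lambda>x. h (pt A \<sigma> x))"
  by (rule polyfun_compose[where g = "pt A \<sigma>"]) simp_all

lemma polyfun_ev: "polyfun n h \<Longrightarrow> polyfun n (\<lambda>v. h (ev B \<sigma> v))"
  by (rule polyfun_compose[where g = "ev B \<sigma>"]) simp_all

text \<open>A cone that contains a line contains the plane through it and \<open>P\<close>. For the
  lines of \<open>S\<close> these planes are distinct, and a suitable line through \<open>v\<close>
  meets them in \<open>card S\<close> distinct points, all roots of one polynomial of degree at most
  \<open>n\<close>.\<close>

lemma card_lines_le:
  assumes inf: "infinite (UNIV :: 'a set)"
    and h: "cone P n h" "h v \<noteq> 0"
    and S: "finite S" "pairwise_indep S" "0 \<notin> S"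
    and van: "\<And>\<sigma> x. \<sigma> \<in> S \<Longrightarrow> h (pt A \<sigma> x) = 0" and P: "\<And>\<sigma>. \<sigma> \<in> S \<Longrightarrow> ev B \<sigma> P \<noteq> 0"
  shows "card S \<le> n"
proof -
  \<comment> \<open>The linear form whose kernel is the plane through \<open>P\<close> and the line
    of \<open>\<sigma>\<close>.\<close>
  define l where "l \<sigma> w = det2 (ev B \<sigma> w) (ev B \<sigma> P)" for \<sigma> w
  have l_lin [simp]: "l \<sigma> (x + y) = l \<sigma> x + l \<sigma> y" "l \<sigma> (c *s x) = c * l \<sigma> x" for \<sigma> x y c
    by (simp_all add: l_def)
  have l0: "h w = 0" if \<sigma>: "\<sigma> \<in> S" "l \<sigma> w = 0" for \<sigma> w
  proof -
    obtain c where "ev B \<sigma> w = c *s ev B \<sigma> P"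
      using \<sigma>(2) det2_eq_0_iff[OF P[OF \<sigma>(1)]] unfolding l_def by blast
    then have "ev B \<sigma> (w + (- c) *s P) = 0" by (simp add: vec2_eq_iff)
    then obtain x where "w + (- c) *s P = pt A \<sigma> x" using ev_eq_0[of \<sigma>] \<sigma>(1) S(3) by metis
    then show ?thesis using van[OF \<sigma>(1), of x] h(1) unfolding cone_def by metis
  qed
  then have lv: "l \<sigma> v \<noteq> 0" if "\<sigma> \<in> S" for \<sigma> using that h(2) by blast
  \<comment> \<open>At a direction \<open>y\<close>, the diagonal entries say that \<open>y\<close>
    is not parallel to a plane, the others that the line \<open>v + t *s y\<close> meets two planes
    at different parameters.\<close>
  define m where "m p w = (if fst p = snd p then l (fst p) w
      else l (fst p) w * l (snd p) v - l (snd p) w * l (fst p) v)" for p w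
  have pl: "polyfun 1 (l \<sigma>)" for \<sigma>
    unfolding l_def by (rule polyfun_ev[OF polyfun_det2_left])
  have pl': "polyfun 1 (\<lambda>w. l \<sigma> w * c)" for \<sigma> c
    using polyfun_cmult[OF pl] by (simp only: mult.commute[of _ c])
  have "\<exists>y. (\<Prod>p\<in>S \<times> S. m p y) \<noteq> 0"
  proof (rule polyfun_nonzero_prod[OF inf, where d = "\<lambda>_. 1"])
    show "polyfun 1 (m p)" for p
      unfolding m_def using pl pl' by (cases "fst p = snd p") (auto intro!: polyfun_diff simp del: One_nat_def)
    show "\<exists>w. m p w \<noteq> 0" if "p \<in> S \<times> S" for p
    proof (cases "fst p = snd p")
      case True
      then have "m p v \<noteq> 0" using lv that by (auto simp: m_def)
      then show ?thesis by blast
    next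
      case False
      define \<sigma> \<tau> where "\<sigma> = fst p" "\<tau> = snd p"
      have st: "\<sigma> \<in> S" "\<tau> \<in> S" "det2 \<sigma> \<tau> \<noteq> 0" using that False S(2)
        by (auto simp: \<sigma>_\<tau>_def pairwise_indep_def)
      obtain x where x: "det2 (ev B \<tau> P) x \<noteq> 0" using ex_det2_nonzero P[OF st(2)] by blast
      \<comment> \<open>This point lies in the plane of \<open>\<sigma>\<close> but, by the choice
        of \<open>x\<close>, not in that of \<open>\<tau>\<close>.\<close>
      have "m p (pt A \<sigma> x) \<noteq> 0"
        using False st lv[of \<sigma>] x det2_swap[of x]
        by (simp add: m_def l_def flip: \<sigma>_\<tau>_def)
      then show ?thesis by blast
    qed
  qed (use S(1) in simp)
  then obtain y where y: "\<And>\<sigma> \<tau>. \<sigma> \<in> S \<Longrightarrow> \<tau> \<in> S \<Longrightarrow> m (\<sigma>, \<tau>) y \<noteq> 0"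
    using S(1) by (auto simp: prod_zero_iff)
  obtain q where q: "degree q \<le> n" "\<And>t. h (v + t *s y) = poly q t"
    using polyfunE h(1) unfolding cone_def by metis
  have ly: "l \<sigma> y \<noteq> 0" if "\<sigma> \<in> S" for \<sigma> using y[OF that that] by (simp add: m_def)
  have "q \<noteq> 0" using q(2)[of 0] h(2) by auto
  define r where "r \<sigma> = - l \<sigma> v / l \<sigma> y" for \<sigma>
  have "poly q (r \<sigma>) = 0" if "\<sigma> \<in> S" for \<sigma>
  proof -
    have "l \<sigma> (v + r \<sigma> *s y) = 0" using ly[OF that] by (simp only: l_lin) (simp add: r_def)
    then show ?thesis using l0[OF that] q(2) by metis
  qed
  then have "r ` S \<subseteq> {t. poly q t = 0}" by blast
  moreover have "inj_on r S"
  proof (rule inj_onI, rule ccontr)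
    fix \<sigma> \<tau> assume "\<sigma> \<in> S" "\<tau> \<in> S" "r \<sigma> = r \<tau>" "\<sigma> \<noteq> \<tau>"
    then show False using y[of \<sigma> \<tau>] ly[of \<sigma>] ly[of \<tau>] by (simp add: r_def m_def field_simps)
  qed
  ultimately have "card S \<le> card {t. poly q t = 0}"
    using card_inj_on_le poly_roots_finite[OF \<open>q \<noteq> 0\<close>] by blast
  also have "\<dots> \<le> n" using card_poly_roots_bound[OF \<open>q \<noteq> 0\<close>] q(1) by linarith
  finally show ?thesis .
qed

text \<open>On each line the cone is a constant times \<open>root_form\<close>. Multiplying the swap
  equations around three lines, every constant occurs once on either side and cancels.\<close>

lemma cone_triple_identity:
  assumes inf: "infinite (UNIV :: 'a set)"
    and f: "cone P n f" "\<And>\<sigma> u. \<sigma> \<in> S \<Longrightarrow> u \<in> U \<sigma> \<Longrightarrow> f (pt A \<sigma> u) = 0"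
    and U: "\<And>\<sigma>. \<sigma> \<in> S \<Longrightarrow> finite (U \<sigma>) \<and> card (U \<sigma>) = n \<and> pairwise_indep (U \<sigma>) \<and> 0 \<notin> U \<sigma>"
    and gen: "\<And>\<sigma> \<tau>. \<sigma> \<in> S \<Longrightarrow> \<tau> \<in> S \<Longrightarrow> \<sigma> \<noteq> \<tau> \<Longrightarrow> root_form (U \<sigma>) (ev B \<tau> P) \<noteq> 0"
    and nz: "\<rho> \<in> S" "f (pt A \<rho> x) \<noteq> 0"
    and ijk: "i \<in> S" "j \<in> S" "k \<in> S" "i \<noteq> j" "i \<noteq> k" "j \<noteq> k"
  shows "root_form (U i) (ev B j P) * root_form (U j) (ev B k P) * root_form (U k) (ev B i P) =
    root_form (U j) (ev B i P) * root_form (U k) (ev B j P) * root_form (U i) (ev B k P)"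
proof -
  have "\<exists>c. \<forall>x. f (pt A \<sigma> x) = c * root_form (U \<sigma>) x" if "\<sigma> \<in> S" for \<sigma>
    by (rule binary_form_eq_root_form[OF inf polyfun_pt])
       (use that f U in \<open>auto simp: cone_def\<close>)
  then obtain c where c: "\<And>\<sigma> x. \<sigma> \<in> S \<Longrightarrow> f (pt A \<sigma> x) = c \<sigma> * root_form (U \<sigma>) x"
    by metis
  have swap: "c \<sigma> * root_form (U \<sigma>) (ev B \<tau> P) = c \<tau> * root_form (U \<tau>) (ev B \<sigma> P)"
    if "\<sigma> \<in> S" "\<tau> \<in> S" for \<sigma> \<tau>
    using cone_pt_swap[OF f(1), of \<sigma> \<tau>] c that by metis
  \<comment> \<open>One nonzero constant forces all others to be nonzero: \<open>swap\<close>
    relates them, and \<open>gen\<close> keeps the factor beside \<open>c \<rho>\<close>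
    nonzero.\<close>
  have "c \<rho> \<noteq> 0" using nz c by fastforce
  then have c0: "c \<sigma> \<noteq> 0" if "\<sigma> \<in> S" for \<sigma>
    using swap[OF that nz(1)] gen[OF nz(1) that] by (cases "\<sigma> = \<rho>") auto
  have "c i * c j * c k *
      (root_form (U i) (ev B j P) * root_form (U j) (ev B k P) * root_form (U k) (ev B i P)) =
    (c i * root_form (U i) (ev B j P)) * (c j * root_form (U j) (ev B k P)) *
      (c k * root_form (U k) (ev B i P))" by (simp add: mult_ac)
  also have "\<dots> = (c j * root_form (U j) (ev B i P)) * (c k * root_form (U k) (ev B j P)) *
      (c i * root_form (U i) (ev B k P))" using swap ijk(1-3) by metis
  also have "\<dots> = c i * c j * c k * (root_form (U j) (ev B i P) * root_form (U k) (ev B j P) *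
      root_form (U i) (ev B k P))" by (simp add: mult_ac)
  finally show ?thesis using c0 ijk(1-3) by simp
qed

end

text \<open>The triple identity for the lines \<open>i\<close>, \<open>k\<close>, \<open>l\<close>
  extends from general \<open>P\<close> to all \<open>P\<close>. It is then evaluated at a
  \<open>P\<close> whose projection from line \<open>k\<close> is the root \<open>u\<close> and
  whose projection from line \<open>i\<close> is a general \<open>y\<close>.\<close>

lemma geproci_transversal:
  fixes A B :: "'a::alg_closed_field ^ 4 ^ 4"
  assumes "frame A B" and gp: "geproci a b Z"
    and S: "finite S" "card S = b" "b \<ge> 3" "pairwise_indep S" "0 \<notin> S"
    and U: "\<And>\<sigma>. \<sigma> \<in> S \<Longrightarrow> finite (U \<sigma>) \<and> card (U \<sigma>) = a \<and> pairwise_indep (U \<sigma>) \<and> 0 \<notin> U \<sigma>"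
    and Z: "\<And>\<sigma> u. \<sigma> \<in> S \<Longrightarrow> u \<in> U \<sigma> \<Longrightarrow> vec.span {pt A \<sigma> u} \<in> Z"
    and il: "i \<in> S" "l \<in> S" "u \<in> U i"
  shows "\<exists>u'\<in>U l. det2 u u' = 0"
proof (cases "i = l")
  case True
  then show ?thesis using il(3) by force
next
  case False
  interpret frame A B by fact
  note inf = infinite_alg_closed[where ?'a = 'a]
  obtain k where k: "k \<in> S" "k \<noteq> i" "k \<noteq> l"
  proof -
    have "card {i, l} < card S" using S(2,3) False by simp
    then have "\<not> S \<subseteq> {i, l}" using card_mono[of "{i, l}" S] by auto
    then show ?thesis using that by blast
  qed
  obtain r N where N: "polyfun r N" "\<exists>v. N v \<noteq> 0"
    "\<And>P. N P \<noteq> 0 \<Longrightarrow> P \<noteq> 0 \<Longrightarrow> \<exists>f g. cone P a f \<and> cone P b g \<and> (\<exists>v. f v \<noteq> 0) \<and>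
      (\<forall>p\<in>Z. \<forall>v\<in>p. f v = 0 \<and> g v = 0) \<and>
      (\<forall>u v. (\<forall>c d e. c *s u + d *s v = e *s P \<longrightarrow> c = 0 \<and> d = 0) \<longrightarrow>
        (\<exists>t. f (u + t *s v) \<noteq> 0 \<or> g (u + t *s v) \<noteq> 0))"
    using geproci_cones[OF gp] by blast
  define D where "D = {(\<sigma>, \<tau>). \<sigma> \<in> S \<and> \<tau> \<in> S \<and> \<sigma> \<noteq> \<tau>}"
  have finD: "finite D" by (rule finite_subset[of _ "S \<times> S"]) (use S(1) in \<open>auto simp: D_def\<close>)
  \<comment> \<open>Nonzero exactly when no projection of \<open>P\<close> from one line is a root
    of the form of another line.\<close>
  define M where "M P = (\<Prod>p\<in>D. root_form (U (fst p)) (ev B (snd p) P))" for P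
  define T where "T P =
    root_form (U i) (ev B k P) * root_form (U k) (ev B l P) * root_form (U l) (ev B i P) -
    root_form (U k) (ev B i P) * root_form (U l) (ev B k P) * root_form (U i) (ev B l P)" for P
  have pf: "polyfun a (\<lambda>P. root_form (U \<sigma>) (ev B \<tau> P))" if "\<sigma> \<in> S" for \<sigma> \<tau>
    using polyfun_ev[OF polyfun_root_form] U[OF that] by metis
  have T_eq_0: "T P = 0" if "N P * M P \<noteq> 0" for P
  proof -
    have gen: "root_form (U \<sigma>) (ev B \<tau> P) \<noteq> 0" if "\<sigma> \<in> S" "\<tau> \<in> S" "\<sigma> \<noteq> \<tau>" for \<sigma> \<tau>
      using \<open>N P * M P \<noteq> 0\<close> that finD by (force simp: M_def D_def prod_zero_iff)
    have root_0: "root_form (U i) 0 = 0" using il U[of i] by (auto simp: root_form_eq_0_iff)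
    have "P \<noteq> 0" using gen[of i l] il(1,2) False root_0 by auto
    then obtain f g where fg: "cone P a f" "cone P b g" "\<exists>v. f v \<noteq> 0"
      "\<And>p v. p \<in> Z \<Longrightarrow> v \<in> p \<Longrightarrow> f v = 0 \<and> g v = 0"
      "\<And>u v. \<forall>c d e. c *s u + d *s v = e *s P \<longrightarrow> c = 0 \<and> d = 0 \<Longrightarrow>
        \<exists>t. f (u + t *s v) \<noteq> 0 \<or> g (u + t *s v) \<noteq> 0"
      using N(3)[of P] \<open>N P * M P \<noteq> 0\<close> by auto
    have van: "f (pt A \<sigma> v) = 0" "g (pt A \<sigma> v) = 0" if "\<sigma> \<in> S" "v \<in> U \<sigma>" for \<sigma> v
      using fg(4)[OF Z[OF that]] vec.span_base[of "pt A \<sigma> v" "{pt A \<sigma> v}"] by auto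
    \<comment> \<open>The triple identity needs a cone of degree \<open>a\<close> that is nonzero on
      some line. If \<open>f\<close> vanishes on all the lines, then \<open>b \<le> a\<close>; since
      the intersection is finite, \<open>g\<close> is nonzero on line \<open>i\<close>, where its
      \<open>a\<close> roots give \<open>a \<le> b\<close>. Then \<open>g\<close> has degree
      \<open>a\<close> and replaces \<open>f\<close>.\<close>
    obtain h \<rho> x where h: "cone P a h" "\<rho> \<in> S" "h (pt A \<rho> x) \<noteq> 0"
      "\<And>\<sigma> v. \<sigma> \<in> S \<Longrightarrow> v \<in> U \<sigma> \<Longrightarrow> h (pt A \<sigma> v) = 0"
    proof (cases "\<exists>\<rho>\<in>S. \<exists>x. f (pt A \<rho> x) \<noteq> 0")
      case True
      then show ?thesis using that fg(1) van(1) by blast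
    next
      case f0: False
      have P: "ev B \<sigma> P \<noteq> 0" if "\<sigma> \<in> S" for \<sigma>
      proof
        assume *: "ev B \<sigma> P = 0"
        obtain \<tau> where \<tau>: "\<tau> \<in> S" "\<tau> \<noteq> \<sigma>" using il(1,2) False by metis
        then have "U \<tau> \<noteq> {}" using il(1,3) U[of i] U[of \<tau>] by force
        then have "root_form (U \<tau>) 0 = 0" using U[OF \<tau>(1)] by (auto simp: root_form_eq_0_iff)
        then show False using gen[OF \<tau>(1) that \<tau>(2)] * by simp
      qed
      obtain w where "f w \<noteq> 0" using fg(3) by blast
      then have "b \<le> a"
        using card_lines_le[OF inf fg(1), of w S] S P f0 by blast
      define e1 e2 :: "'a ^ 2" where "e1 = vector [1, 0]" "e2 = vector [0, 1]"
      have "\<exists>t. f (pt A i e1 + t *s pt A i e2) \<noteq> 0 \<or> g (pt A i e1 + t *s pt A i e2) \<noteq> 0"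
      \<comment> \<open>Line \<open>i\<close> misses \<open>P\<close> because
        \<open>ev B i P\<close> is nonzero, so its two basis vectors stay independent modulo
        \<open>P\<close>.\<close>
      proof (rule fg(5), intro allI impI)
        fix c d e assume *: "c *s pt A i e1 + d *s pt A i e2 = e *s P"
        have "e *s ev B i P = ev B i (c *s pt A i e1 + d *s pt A i e2)" using * by simp
        also have "\<dots> = 0" by simp
        finally have "e = 0" using P[OF il(1)] by simp
        then have "pt A i (c *s e1 + d *s e2) = 0" using * by simp
        then have "c *s e1 + d *s e2 = 0" using il(1) S(5) pt_eq_0_iff by metis
        then show "c = 0 \<and> d = 0" by (simp add: e1_e2_def vec2_eq_iff)
      qed
      then obtain t where
        "f (pt A i (e1 + t *s e2)) \<noteq> 0 \<or> g (pt A i (e1 + t *s e2)) \<noteq> 0" by auto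
      then have "g (pt A i (e1 + t *s e2)) \<noteq> 0" using f0 il(1) by blast
      moreover have "g (pt A i x) = 0" if "\<not> a \<le> b" for x
        by (rule binary_form_eq_0[where h = "\<lambda>x. g (pt A i x)" and U = "U i" and n = b,
              OF inf polyfun_pt])
           (use that U[OF il(1)] van(2)[OF il(1)] fg(2) in \<open>simp_all add: cone_def\<close>)
      ultimately have "a \<le> b" "\<exists>x. g (pt A i x) \<noteq> 0" by blast+
      then show ?thesis using that fg(2) il(1) van(2) \<open>b \<le> a\<close> by (metis order_antisym)
    qed
    show ?thesis
      unfolding T_def using cone_triple_identity[OF inf h(1), of S U \<rho> x i k l] h(2-4) U gen k il False
      by auto
  qed
  \<comment> \<open>The product of \<open>N\<close>, \<open>M\<close> and \<open>T\<close> vanishes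
    everywhere; as \<open>N\<close> and \<open>M\<close> are not identically zero, \<open>T\<close>
    must be.\<close>
  have "T P = 0" for P
  proof (rule ccontr)
    assume "T P \<noteq> 0"
    have "\<exists>P. M P \<noteq> 0" unfolding M_def
    proof (rule polyfun_nonzero_prod[OF inf finD, where d = "\<lambda>_. a"])
      fix p assume "p \<in> D"
      then obtain \<sigma> \<tau> where p: "p = (\<sigma>, \<tau>)" "\<sigma> \<in> S" "\<tau> \<in> S" "\<sigma> \<noteq> \<tau>" by (auto simp: D_def)
      show "polyfun a (\<lambda>v. root_form (U (fst p)) (ev B (snd p) v))" using pf p by simp
      obtain x where x: "root_form (U \<sigma>) x \<noteq> 0" using root_form_nonzero[OF inf] U p(2) by blast
      have "det2 \<sigma> \<tau> \<noteq> 0" using p S(4) by (auto simp: pairwise_indep_def)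
      \<comment> \<open>The scaled point on line \<open>\<sigma>\<close> is chosen so that its
        projection from line \<open>\<tau>\<close> is exactly \<open>x\<close>.\<close>
      then have "root_form (U \<sigma>) (ev B \<tau> (inverse (det2 \<sigma> \<tau>) *s pt A \<sigma> x)) \<noteq> 0"
        using x by (simp add: vec.scale_scale)
      then show "\<exists>v. root_form (U (fst p)) (ev B (snd p) v) \<noteq> 0"
        unfolding p(1) fst_conv snd_conv by blast
    qed
    moreover have M: "polyfun (\<Sum>p\<in>D. a) M" unfolding M_def[abs_def]
      by (rule polyfun_prod) (use pf in \<open>auto simp: D_def\<close>)
    ultimately obtain P' where "N P' * M P' \<noteq> 0"
      using polyfun_nonzero_mult[OF inf N(1) M] N(2) by blast
    moreover have "polyfun (r + (\<Sum>p\<in>D. a)) (\<lambda>P. N P * M P)" by (rule polyfun_mult[OF N(1) M])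
    moreover have "polyfun (a + a + a) T" unfolding T_def[abs_def]
      by (intro polyfun_diff polyfun_mult pf il k)
    ultimately have "\<exists>x. (N x * M x) * T x \<noteq> 0"
      using polyfun_nonzero_mult[OF inf] \<open>T P \<noteq> 0\<close> by blast
    then show False using T_eq_0 by auto
  qed
  define d where "d = det2 i k"
  have d: "d \<noteq> 0" "det2 k i = - d" "det2 k l \<noteq> 0"
    using S(4) il k det2_swap[of k i] by (auto simp: d_def pairwise_indep_def)
  define \<alpha> \<beta> where "\<alpha> = - det2 k l / d" "\<beta> = det2 i l / d"
  \<comment> \<open>The special centre: a point of line \<open>i\<close> minus a point of line
    \<open>k\<close>, scaled so that the projections from \<open>k\<close> and \<open>i\<close>
    become \<open>u\<close> and \<open>y\<close>. The projection from \<open>l\<close> is then a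
    combination in which \<open>y\<close> has the nonzero coefficient
    \<open>\<alpha>\<close>.\<close>
  have ev_P: "ev B k (inverse d *s pt A i u - inverse d *s pt A k y) = u"
    "ev B i (inverse d *s pt A i u - inverse d *s pt A k y) = y"
    "ev B l (inverse d *s pt A i u - inverse d *s pt A k y) = \<alpha> *s y + \<beta> *s u" for y
    using d by (simp_all add: vec.scale_scale vec2_eq_iff \<alpha>_\<beta>_def field_simps flip: d_def)
  have Ui: "root_form (U i) u = 0"
    using il U[of i] by (auto simp: root_form_eq_0_iff intro!: bexI[of _ u])
  \<comment> \<open>With this \<open>y\<close> only \<open>root_form (U l) u\<close> can make the
    surviving product of the identity vanish. The second factor is not identically zero because
    \<open>\<alpha> \<noteq> 0\<close> makes the substitution surjective.\<close>
  obtain y where y: "root_form (U k) y * root_form (U i) (\<alpha> *s y + \<beta> *s u) \<noteq> 0"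
  proof -
    obtain x where x: "root_form (U i) x \<noteq> 0" using root_form_nonzero[OF inf] U il(1) by blast
    obtain z where z: "root_form (U k) z \<noteq> 0" using root_form_nonzero[OF inf] U k(1) by blast
    have "\<alpha> *s (inverse \<alpha> *s (x - \<beta> *s u)) + \<beta> *s u = x" using d
      by (simp add: vec.scale_scale \<alpha>_\<beta>_def)
    then have "root_form (U i) (\<alpha> *s (inverse \<alpha> *s (x - \<beta> *s u)) + \<beta> *s u) \<noteq> 0"
      using x by simp
    moreover have "polyfun (card (U i)) (\<lambda>y. root_form (U i) (\<alpha> *s y + \<beta> *s u))"
      by (rule polyfun_compose[OF polyfun_root_form, where g = "\<lambda>y. \<alpha> *s y"])
         (simp add: vec_eq_iff algebra_simps)
    ultimately show ?thesis
      using polyfun_nonzero_mult[OF inf polyfun_root_form _ z] that by blast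
  qed
  have "root_form (U k) y * root_form (U l) u * root_form (U i) (\<alpha> *s y + \<beta> *s u) = 0"
    using \<open>T (inverse d *s pt A i u - inverse d *s pt A k y) = 0\<close>
    unfolding T_def ev_P Ui by simp
  then have "root_form (U l) u = 0" using y by simp
  then show ?thesis using U[OF il(2)] by (simp add: root_form_eq_0_iff)
qed

section \<open>Skew lines and transversals\<close>

lemma points_on_meet:
  assumes "proj_line L" "proj_line M"
  shows "points_on L \<inter> points_on M \<noteq> {} \<longleftrightarrow> (\<exists>v. v \<noteq> 0 \<and> v \<in> L \<and> v \<in> M)"
proof
  assume "points_on L \<inter> points_on M \<noteq> {}"
  then obtain p where p: "proj_point p" "p \<subseteq> L" "p \<subseteq> M" by (auto simp: points_on_def)
  then obtain v where "v \<noteq> 0" "p = vec.span {v}" using proj_pointE by blast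
  then show "\<exists>v. v \<noteq> 0 \<and> v \<in> L \<and> v \<in> M" using p vec.span_base[of v "{v}"] by blast
next
  assume "\<exists>v. v \<noteq> 0 \<and> v \<in> L \<and> v \<in> M"
  then obtain v where v: "v \<noteq> 0" "v \<in> L" "v \<in> M" by blast
  then have "vec.span {v} \<subseteq> L" "vec.span {v} \<subseteq> M"
    using assms by (simp_all add: vec.span_minimal proj_line_def)
  then have "vec.span {v} \<in> points_on L \<inter> points_on M"
    using v(1) by (simp add: points_on_def proj_point_span)
  then show "points_on L \<inter> points_on M \<noteq> {}" by blast
qed

lemma skew_linesD:
  assumes "skew_lines \<L>" "L \<in> \<L>" "M \<in> \<L>" "v \<in> L" "v \<in> M" "v \<noteq> 0"
  shows "L = M"
  using assms points_on_meet[of L M] unfolding skew_lines_def by blast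

lemma span_pair: "vec.span {u, v} = {c *s u + d *s v | c d. True}" (is "?A = ?B")
proof
  show "?A \<subseteq> ?B"
    by (auto simp: vec.span_insert vec.span_singleton) (metis add.commute diff_add_cancel)
  show "?B \<subseteq> ?A" by (auto intro!: vec.span_add vec.span_scale intro: vec.span_base)
qed

lemma independent_pair:
  assumes "\<And>c d. c *s u + d *s v = 0 \<Longrightarrow> c = 0 \<and> d = 0"
  shows "vec.independent {u, v}" "card {u, v} = 2"
proof -
  have uv: "u \<noteq> v" "v \<noteq> 0" using assms[of 1 "-1"] assms[of 0 1] by auto
  have "u \<notin> vec.span {v}"
  proof
    assume "u \<in> vec.span {v}"
    then obtain k where "u = k *s v" by (auto simp: vec.span_singleton)
    then show False using assms[of 1 "- k"] by simp
  qed
  then show "vec.independent {u, v}" "card {u, v} = 2" using uv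
    by (simp_all add: vec.independent_insert)
qed

lemma line_eqI:
  assumes L: "proj_line L" "u \<in> L" "v \<in> L" and indep: "\<And>c d. c *s u + d *s v = 0 \<Longrightarrow> c = 0 \<and> d = 0"
  shows "L = {c *s u + d *s v | c d. True}"
proof -
  have "L = vec.span {u, v}"
    using L independent_pair[of u v, OF indep] vec.card_ge_dim_independent[of "{u, v}" L]
      vec.span_minimal[of "{u, v}" L]
    by (auto simp: proj_line_def)
  then show ?thesis by (simp add: span_pair)
qed

lemma proj_lineI:
  assumes "\<And>c d. c *s u + d *s v = 0 \<Longrightarrow> c = 0 \<and> d = 0"
  shows "proj_line {c *s u + d *s v | c d. True}"
  unfolding span_pair[symmetric] proj_line_def
  using vec.dim_span_eq_card_independent[OF independent_pair(1)[of u v, OF assms]]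
    independent_pair(2)[of u v, OF assms] by simp

lemma proj_lineE:
  assumes "proj_line L"
  obtains u v where "u \<in> L" "v \<in> L" "\<And>c d. c *s u + d *s v = 0 \<Longrightarrow> c = 0 \<and> d = 0"
proof -
  obtain B where B: "B \<subseteq> L" "vec.independent B" "L \<subseteq> vec.span B" "card B = vec.dim L"
    using vec.basis_exists by blast
  then obtain u v where uv: "B = {u, v}" "u \<noteq> v"
    using assms by (auto simp: proj_line_def card_2_iff)
  then have "u \<notin> vec.span {v}" "v \<noteq> 0" using B(2)
    by (auto simp: vec.independent_insert vec.dependent_single split: if_splits)
  have "c = 0 \<and> d = 0" if "c *s u + d *s v = 0" for c d
  proof -
    have "c = 0"
    proof (rule ccontr)
      assume "c \<noteq> 0"
      have "u = (- d / c) *s v"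
        using that \<open>c \<noteq> 0\<close> by (auto simp: vec_eq_iff field_simps eq_neg_iff_add_eq_0)
      then show False using \<open>u \<notin> vec.span {v}\<close> unfolding vec.span_singleton by blast
    qed
    then show ?thesis using that \<open>v \<noteq> 0\<close> by simp
  qed
  then show ?thesis using that B(1) uv(1) by blast
qed

lemma line_subset_eq: "proj_line L \<Longrightarrow> proj_line M \<Longrightarrow> L \<subseteq> M \<Longrightarrow> L = M"
  unfolding proj_line_def by (metis vec.subspace_dim_equal order_refl)

text \<open>Vector description of the plane that occurs in \<open>line_map\<close>.\<close>

lemma span_point_subspace:
  assumes "vec.subspace N"
  shows "x \<in> vec.span (vec.span {v} \<union> N) \<longleftrightarrow> (\<exists>c. x - c *s v \<in> N)"
proof -
  have "vec.span (vec.span {v} \<union> N) = vec.span (insert v N)"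
  proof
    show "vec.span (vec.span {v} \<union> N) \<subseteq> vec.span (insert v N)"
      using vec.span_mono[of "{v}" "insert v N"] vec.span_superset[of "insert v N"]
      by (intro vec.span_minimal) auto
    show "vec.span (insert v N) \<subseteq> vec.span (vec.span {v} \<union> N)"
      using vec.span_superset[of "vec.span {v} \<union> N"] vec.span_base[of v "{v}"]
      by (intro vec.span_minimal) auto
  qed
  moreover have "vec.span N = N" using assms by (simp add: vec.span_eq_iff)
  ultimately show ?thesis by (simp only: vec.span_breakdown_eq)
qed

text \<open>A matrix with independent columns has trivial kernel, hence a left inverse.\<close>

lemma frame_of_columns:
  fixes a1 a2 a3 a4 :: "'a::field ^ 4"
  assumes "\<And>c1 c2 c3 c4. c1 *s a1 + c2 *s a2 + c3 *s a3 + c4 *s a4 = 0 \<Longrightarrow>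
    c1 = 0 \<and> c2 = 0 \<and> c3 = 0 \<and> c4 = 0"
  shows "\<exists>A B. frame A B \<and>
    (\<forall>c. A *v c = c $ 1 *s a1 + c $ 2 *s a2 + c $ 3 *s a3 + c $ 4 *s a4)"
proof -
  define A :: "'a ^ 4 ^ 4"
    where "A = (\<chi> i j. if j = 1 then a1 $ i else if j = 2 then a2 $ i else if j = 3 then a3 $ i else a4 $ i)"
  have A: "A *v c = c $ 1 *s a1 + c $ 2 *s a2 + c $ 3 *s a3 + c $ 4 *s a4" for c
    by (simp add: A_def matrix_vector_mult_def vec_eq_iff sum_4 mult.commute)
  have "c = 0" if "A *v c = 0" for c
    using assms[of "c $ 1" "c $ 2" "c $ 3" "c $ 4"] that unfolding A
    by (simp only: vec_eq_iff forall_4 zero_index simp_thms)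
  then obtain B where "B ** A = mat 1" using matrix_left_invertible_ker[of A] by blast
  then show ?thesis using A by (intro exI[of _ A] exI[of _ B]) (simp add: frame_def)
qed

text \<open>With \<open>axis1 + axis2\<close> these are the reference points of the projective line;
  three given skew lines are placed at them.\<close>

definition axis1 :: "'a::field ^ 2" where "axis1 = vector [1, 0]"
definition axis2 :: "'a::field ^ 2" where "axis2 = vector [0, 1]"

lemma axis_simps [simp]: "axis1 $ 1 = 1" "axis1 $ 2 = 0" "axis2 $ 1 = 0" "axis2 $ 2 = 1"
  by (simp_all add: axis1_def axis2_def)

lemma det2_axis [simp]: "det2 axis1 axis2 = 1" "det2 axis2 axis1 = -1"
  by (simp_all add: det2_def)

lemma axis_nonzero [simp]: "axis1 \<noteq> 0" "axis2 \<noteq> 0" "axis1 + axis2 \<noteq> 0" "axis1 - c *s axis2 \<noteq> 0"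
  by (simp_all add: vec2_eq_iff)

section \<open>The two rulings of the quadric of a frame\<close>

context frame begin

definition ruling :: "'a ^ 2 \<Rightarrow> ('a ^ 4) set" where "ruling \<sigma> = range (pt A \<sigma>)"
definition opp :: "'a ^ 2 \<Rightarrow> ('a ^ 4) set" where "opp x = range (\<lambda>\<sigma>. pt A \<sigma> x)"

lemma pt_in [simp]: "pt A \<sigma> x \<in> ruling \<sigma>" "pt A \<sigma> x \<in> opp x"
  by (auto simp: ruling_def opp_def)

lemma vec2_expand: "x = x $ 1 *s axis1 + x $ 2 *s (axis2 :: 'a ^ 2)"
  by (simp add: vec2_eq_iff)

lemma ruling_eq: "ruling \<sigma> = {c *s pt A \<sigma> axis1 + d *s pt A \<sigma> axis2 | c d. True}"
proof -
  have "pt A \<sigma> x = x $ 1 *s pt A \<sigma> axis1 + x $ 2 *s pt A \<sigma> axis2" for x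
    by (subst vec2_expand[of x]) simp
  moreover have "c *s pt A \<sigma> axis1 + d *s pt A \<sigma> axis2 = pt A \<sigma> (c *s axis1 + d *s axis2)" for c d
    by simp
  ultimately show ?thesis unfolding ruling_def by blast
qed

lemma opp_eq: "opp x = {c *s pt A axis1 x + d *s pt A axis2 x | c d. True}"
proof -
  have "pt A \<sigma> x = \<sigma> $ 1 *s pt A axis1 x + \<sigma> $ 2 *s pt A axis2 x" for \<sigma>
    by (subst vec2_expand[of \<sigma>]) simp
  moreover have "c *s pt A axis1 x + d *s pt A axis2 x = pt A (c *s axis1 + d *s axis2) x" for c d
    by simp
  ultimately show ?thesis unfolding opp_def by blast
qed

lemma proj_line_ruling: "\<sigma> \<noteq> 0 \<Longrightarrow> proj_line (ruling \<sigma>)"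
  unfolding ruling_eq
proof (rule proj_lineI)
  fix c d assume "\<sigma> \<noteq> 0" "c *s pt A \<sigma> axis1 + d *s pt A \<sigma> axis2 = 0"
  then have "pt A \<sigma> (c *s axis1 + d *s axis2) = 0" by simp
  then show "c = 0 \<and> d = 0" using \<open>\<sigma> \<noteq> 0\<close> by (simp only: pt_eq_0_iff) (simp add: vec2_eq_iff)
qed

lemma proj_line_opp: "x \<noteq> 0 \<Longrightarrow> proj_line (opp x)"
  unfolding opp_eq
proof (rule proj_lineI)
  fix c d assume "x \<noteq> 0" "c *s pt A axis1 x + d *s pt A axis2 x = 0"
  then have "pt A (c *s axis1 + d *s axis2) x = 0" by simp
  then show "c = 0 \<and> d = 0" using \<open>x \<noteq> 0\<close> by (simp only: pt_eq_0_iff) (simp add: vec2_eq_iff)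
qed

lemma subspace_ruling: "vec.subspace (ruling \<sigma>)"
  by (cases "\<sigma> = 0") (use proj_line_ruling in \<open>auto simp: proj_line_def ruling_def\<close>)

text \<open>Projecting from the line of \<open>\<tau>\<close> kills the right-hand point, so
  \<open>\<sigma>\<close> and \<open>\<tau>\<close> are proportional; projecting from a line
  independent of \<open>\<sigma>\<close> recovers the other coordinate up to a factor.\<close>

lemma pt_eq_imp:
  assumes "pt A \<sigma> x = pt A \<tau> y" "pt A \<sigma> x \<noteq> 0"
  shows "det2 \<sigma> \<tau> = 0" "det2 x y = 0"
proof -
  have "det2 \<sigma> \<tau> *s x = 0" using ev_pt[of \<tau> \<sigma> x] assms(1) by simp
  then show "det2 \<sigma> \<tau> = 0" using assms(2) by auto
  have "\<sigma> \<noteq> 0" using assms(2) by auto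
  then obtain \<rho> where \<rho>: "det2 \<sigma> \<rho> \<noteq> 0" using ex_det2_nonzero by blast
  have "det2 \<sigma> \<rho> *s x = det2 \<tau> \<rho> *s y" using ev_pt[of \<rho>] assms(1) by metis
  then have "det2 \<sigma> \<rho> * det2 x y = 0" by (metis det2_simps(1,8) mult_zero_right)
  then show "det2 x y = 0" using \<rho> by simp
qed

lemma ruling_proportional:
  assumes "\<sigma> \<noteq> 0" "\<tau> \<noteq> 0" "det2 \<sigma> \<tau> = 0"
  shows "ruling \<sigma> = ruling \<tau>"
proof (rule line_subset_eq)
  obtain c where "\<sigma> = c *s \<tau>" using det2_eq_0_iff assms by blast
  then have "pt A \<sigma> x = pt A \<tau> (c *s x)" for x by simp
  then show "ruling \<sigma> \<subseteq> ruling \<tau>" unfolding ruling_def by blast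
qed (use assms proj_line_ruling in auto)

lemma opp_proportional:
  assumes "x \<noteq> 0" "y \<noteq> 0" "det2 x y = 0"
  shows "opp x = opp y"
proof (rule line_subset_eq)
  obtain c where "x = c *s y" using det2_eq_0_iff assms by blast
  then have "pt A \<sigma> x = pt A (c *s \<sigma>) y" for \<sigma> by simp
  then show "opp x \<subseteq> opp y" unfolding opp_def by blast
qed (use assms proj_line_opp in auto)

lemma span_pt_proportional:
  assumes "x \<noteq> 0" "y \<noteq> 0" "det2 x y = 0"
  shows "vec.span {pt A \<sigma> x} = vec.span {pt A \<sigma> y}"
proof (cases "\<sigma> = 0")
  case False
  obtain c where "x = c *s y" using det2_eq_0_iff assms by blast
  moreover from this have "c \<noteq> 0" using assms by auto
  ultimately show ?thesis using assms(1) False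
    by (subst span_singleton_eq_iff) (auto simp: pt_eq_0_iff)
qed simp

lemma ruling_Int_opp: "\<sigma> \<noteq> 0 \<Longrightarrow> ruling \<sigma> \<inter> opp x = vec.span {pt A \<sigma> x}"
proof (cases "x = 0")
  case True
  then show ?thesis using subspace_ruling vec.subspace_0 by (auto simp: opp_def)
next
  case False
  assume \<sigma>: "\<sigma> \<noteq> 0"
  show ?thesis
  proof
    show "vec.span {pt A \<sigma> x} \<subseteq> ruling \<sigma> \<inter> opp x"
      using subspace_ruling proj_line_opp[OF False]
      by (intro vec.span_minimal vec.subspace_inter) (auto simp: proj_line_def)
    show "ruling \<sigma> \<inter> opp x \<subseteq> vec.span {pt A \<sigma> x}"
    proof
      fix v assume "v \<in> ruling \<sigma> \<inter> opp x"
      then obtain y \<tau> where v: "v = pt A \<sigma> y" "v = pt A \<tau> x" unfolding ruling_def opp_def by blast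
      show "v \<in> vec.span {pt A \<sigma> x}"
      proof (cases "v = 0")
        case True
        then show ?thesis by (simp add: vec.span_zero)
      next
        case nz: False
        then have "det2 \<tau> \<sigma> = 0" using pt_eq_imp(1)[of \<tau> x \<sigma> y] v by simp
        then obtain c where "\<tau> = c *s \<sigma>" using det2_eq_0_iff \<sigma> by blast
        then show ?thesis using v(2) by (simp add: vec.span_base vec.span_scale)
      qed
    qed
  qed
qed

text \<open>A line meeting three lines of the opposite ruling lies in the ruling. The first two
  meeting points span \<open>M\<close>; writing the third in terms of them and comparing
  coefficients of the independent \<open>u\<close> and \<open>v\<close> moves the first two points
  to the parameter \<open>\<tau>\<close>.\<close>

lemma line_in_ruling:
  assumes M: "proj_line M" and U: "det2 u v \<noteq> 0" "det2 u w \<noteq> 0" "det2 v w \<noteq> 0"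
    and meet: "\<rho> \<noteq> 0" "\<sigma> \<noteq> 0" "\<tau> \<noteq> 0" "pt A \<rho> u \<in> M" "pt A \<sigma> v \<in> M" "pt A \<tau> w \<in> M"
  shows "\<exists>\<sigma>. \<sigma> \<noteq> 0 \<and> M = ruling \<sigma>"
proof -
  define a b where "a = det2 w v / det2 u v" "b = det2 u w / det2 u v"
  have ab: "a \<noteq> 0" "b \<noteq> 0" using U det2_swap[of w v] by (auto simp: a_b_def)
  have "det2 u v *s w = det2 u v *s (a *s u + b *s v)"
    using cramer2[of u v w] U(1) by (simp add: a_b_def vec.scale_right_distrib vec.scale_scale)
  then have w: "w = a *s u + b *s v" using U(1) by (simp add: vec.scale_left_imp_eq)
  \<comment> \<open>For independent \<open>u\<close> and \<open>v\<close> the opposite lines are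
    skew, so coefficients can be compared.\<close>
  have ev_uv: "x = 0 \<and> y = 0" if "pt A x u + pt A y v = 0" for x y
  proof -
    have "pt A x u = pt A (- y) v"
      using that pt_add(2)[of y "- y" v] by (simp add: add_eq_0_iff)
    then have "pt A x u = 0" using pt_eq_imp(2) U(1) by blast
    moreover from this have "pt A y v = 0" using that by simp
    ultimately show ?thesis using U by (auto simp: pt_eq_0_iff)
  qed
  have "M = {c *s pt A \<rho> u + d *s pt A \<sigma> v | c d. True}"
  proof (rule line_eqI[OF M meet(4,5)])
    fix c d assume "c *s pt A \<rho> u + d *s pt A \<sigma> v = 0"
    then have "pt A (c *s \<rho>) u + pt A (d *s \<sigma>) v = 0" by simp
    then have "c *s \<rho> = 0" "d *s \<sigma> = 0" using ev_uv by blast+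
    then show "c = 0 \<and> d = 0" using meet by simp
  qed
  then obtain c d where cd: "pt A \<tau> w = c *s pt A \<rho> u + d *s pt A \<sigma> v" using meet(6) by auto
  have "pt A (a *s \<tau> - c *s \<rho>) u + pt A (b *s \<tau> - d *s \<sigma>) v = 0"
  proof -
    have "pt A (a *s \<tau> - c *s \<rho>) u + pt A (b *s \<tau> - d *s \<sigma>) v =
        (a *s pt A \<tau> u + b *s pt A \<tau> v) - (c *s pt A \<rho> u + d *s pt A \<sigma> v)"
      by (simp add: algebra_simps)
    also have "\<dots> = 0" using cd by (simp add: w)
    finally show ?thesis .
  qed
  then have eqs: "a *s \<tau> = c *s \<rho>" "b *s \<tau> = d *s \<sigma>" using ev_uv by fastforce+
  have Ms: "vec.subspace M" using M by (simp add: proj_line_def)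
  have "c *s pt A \<rho> u \<in> M" "d *s pt A \<sigma> v \<in> M"
    using meet Ms by (auto intro: vec.subspace_scale)
  then have "a *s pt A \<tau> u \<in> M" "b *s pt A \<tau> v \<in> M"
    unfolding pt_scale(2)[symmetric] eqs by simp_all
  then have tuv: "pt A \<tau> u \<in> M" "pt A \<tau> v \<in> M" using ab subspace_scale_iff[OF Ms] by blast+
  have "pt A \<tau> x \<in> M" for x
  proof -
    have "det2 u v *s pt A \<tau> x = det2 x v *s pt A \<tau> u + det2 u x *s pt A \<tau> v"
      using arg_cong[OF cramer2[of u v x], of "pt A \<tau>"] by simp
    also have "\<dots> \<in> M" using tuv Ms by (intro vec.subspace_add vec.subspace_scale)
    finally show ?thesis using subspace_scale_iff[OF Ms U(1)] by blast
  qed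
  then have "ruling \<tau> \<subseteq> M" by (auto simp: ruling_def)
  then show ?thesis using line_subset_eq[OF proj_line_ruling M] meet(3) by metis
qed

text \<open>The plane through a point and the line of \<open>\<rho>\<close> contains two points of
  the opposite line of \<open>u\<close>, hence that whole line and its point on the line of
  \<open>\<tau>\<close>. Thus the generators of the groupoid preserve the coordinate
  \<open>u\<close>.\<close>

lemma line_map_ruling:
  assumes "det2 \<sigma> \<rho> \<noteq> 0" "det2 \<tau> \<rho> \<noteq> 0" "u \<noteq> 0"
  shows "line_map (ruling \<sigma>) (ruling \<tau>) (ruling \<rho>) (vec.span {pt A \<sigma> u}) = vec.span {pt A \<tau> u}"
proof -
  have nz: "\<sigma> \<noteq> 0" "\<tau> \<noteq> 0" using assms by auto
  have "vec.span {pt A \<sigma> u} \<in> points_on (ruling \<sigma>)"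
    using nz assms(3) vec.span_minimal[OF _ subspace_ruling[of \<sigma>], of "{pt A \<sigma> u}"]
    by (auto simp: points_on_def pt_eq_0_iff proj_point_span)
  then have "line_map (ruling \<sigma>) (ruling \<tau>) (ruling \<rho>) (vec.span {pt A \<sigma> u}) =
      vec.span (vec.span {pt A \<sigma> u} \<union> ruling \<rho>) \<inter> ruling \<tau>"
    by (simp add: line_map_def)
  also have "\<dots> = vec.span {pt A \<tau> u}"
  proof
    have "pt A \<tau> u - (det2 \<tau> \<rho> / det2 \<sigma> \<rho>) *s pt A \<sigma> u \<in> ruling \<rho>"
    proof -
      have "det2 \<sigma> \<rho> *s pt A \<tau> u = det2 \<tau> \<rho> *s pt A \<sigma> u + det2 \<sigma> \<tau> *s pt A \<rho> u"
        using arg_cong[OF cramer2[of \<sigma> \<rho> \<tau>], of "\<lambda>x. pt A x u"] by simp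
      then have "inverse (det2 \<sigma> \<rho>) *s (det2 \<sigma> \<rho> *s pt A \<tau> u) =
          inverse (det2 \<sigma> \<rho>) *s (det2 \<tau> \<rho> *s pt A \<sigma> u + det2 \<sigma> \<tau> *s pt A \<rho> u)" by simp
      then have "pt A \<tau> u - (det2 \<tau> \<rho> / det2 \<sigma> \<rho>) *s pt A \<sigma> u =
          (det2 \<sigma> \<tau> / det2 \<sigma> \<rho>) *s pt A \<rho> u"
        using assms(1) by (simp add: vec.scale_right_distrib vec.scale_scale divide_inverse mult.commute)
      then show ?thesis using subspace_ruling by (simp add: vec.subspace_scale)
    qed
    then have "pt A \<tau> u \<in> vec.span (vec.span {pt A \<sigma> u} \<union> ruling \<rho>)"
      using span_point_subspace[OF subspace_ruling] by blast
    then show "vec.span {pt A \<tau> u} \<subseteq> vec.span (vec.span {pt A \<sigma> u} \<union> ruling \<rho>) \<inter> ruling \<tau>"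
      by (intro vec.span_minimal vec.subspace_inter subspace_ruling) auto
    show "vec.span (vec.span {pt A \<sigma> u} \<union> ruling \<rho>) \<inter> ruling \<tau> \<subseteq> vec.span {pt A \<tau> u}"
    proof
      fix v assume "v \<in> vec.span (vec.span {pt A \<sigma> u} \<union> ruling \<rho>) \<inter> ruling \<tau>"
      then obtain c x y where v: "v - c *s pt A \<sigma> u = pt A \<rho> x" "v = pt A \<tau> y"
        using span_point_subspace[OF subspace_ruling] by (auto simp: ruling_def)
      \<comment> \<open>Projection from the line of \<open>\<rho>\<close> leaves \<open>y\<close>
        proportional to \<open>u\<close>.\<close>
      have "ev B \<rho> (v - c *s pt A \<sigma> u) = 0" using v(1) by simp
      then have "det2 \<tau> \<rho> *s y = (c * det2 \<sigma> \<rho>) *s u" using v(2) by (simp add: vec.scale_scale)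
      then have "inverse (det2 \<tau> \<rho>) *s (det2 \<tau> \<rho> *s y) = inverse (det2 \<tau> \<rho>) *s ((c * det2 \<sigma> \<rho>) *s u)"
        by simp
      then have "y = (inverse (det2 \<tau> \<rho>) * (c * det2 \<sigma> \<rho>)) *s u"
        using assms(2) by (simp add: vec.scale_scale)
      then show "v \<in> vec.span {pt A \<tau> u}" using v(2) by (simp add: vec.span_base vec.span_scale)
    qed
  qed
  finally show ?thesis .
qed

end

text \<open>The space is the direct sum of \<open>L1\<close> and \<open>L2\<close>, and
  \<open>L3\<close> is the graph of an isomorphism between them. The components of a basis of
  \<open>L3\<close> form the basis of the frame.\<close>

lemma exists_frame:
  fixes L1 L2 L3 :: "('a::field ^ 4) set"
  assumes lines: "proj_line L1" "proj_line L2" "proj_line L3"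
    and disj: "L1 \<inter> L2 \<subseteq> {0}" "L1 \<inter> L3 \<subseteq> {0}" "L2 \<inter> L3 \<subseteq> {0}"
  shows "\<exists>A B. frame A B \<and> L1 = frame.ruling A axis1 \<and> L2 = frame.ruling A axis2 \<and>
    L3 = frame.ruling A (axis1 + axis2)"
proof -
  have sub: "vec.subspace L1" "vec.subspace L2" "vec.subspace L3"
    using lines by (simp_all add: proj_line_def)
  have zero: "x = 0 \<and> y = 0" if "x \<in> L1" "y \<in> L2" "x + y = 0" for x y
  proof -
    have "y = - x" using that(3) by (simp add: add_eq_0_iff)
    then have "y \<in> L1" using that(1) sub(1) vec.subspace_neg by blast
    then show ?thesis using disj(1) that by auto
  qed
  obtain u1 v1 where 1: "u1 \<in> L1" "v1 \<in> L1" "\<And>c d. c *s u1 + d *s v1 = 0 \<Longrightarrow> c = 0 \<and> d = 0"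
    using proj_lineE[OF lines(1)] by blast
  obtain u2 v2 where 2: "u2 \<in> L2" "v2 \<in> L2" "\<And>c d. c *s u2 + d *s v2 = 0 \<Longrightarrow> c = 0 \<and> d = 0"
    using proj_lineE[OF lines(2)] by blast
  obtain u3 v3 where 3: "u3 \<in> L3" "v3 \<in> L3" "\<And>c d. c *s u3 + d *s v3 = 0 \<Longrightarrow> c = 0 \<and> d = 0"
    using proj_lineE[OF lines(3)] by blast
  have comb: "c *s x + d *s y \<in> M" if "vec.subspace M" "x \<in> M" "y \<in> M" for M c d and x y :: "'a ^ 4"
    using that by (intro vec.subspace_add vec.subspace_scale)
  obtain A B where AB: "frame A B"
    "\<And>c. A *v c = c $ 1 *s u1 + c $ 2 *s v1 + c $ 3 *s u2 + c $ 4 *s v2"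
  proof -
    have "\<exists>A B. frame A B \<and>
      (\<forall>c. A *v c = c $ 1 *s u1 + c $ 2 *s v1 + c $ 3 *s u2 + c $ 4 *s v2)"
    proof (rule frame_of_columns)
      fix c1 c2 c3 c4 assume "c1 *s u1 + c2 *s v1 + c3 *s u2 + c4 *s v2 = 0"
      then have "c1 *s u1 + c2 *s v1 = 0 \<and> c3 *s u2 + c4 *s v2 = 0"
        using comb 1(1,2) 2(1,2) sub by (intro zero) (auto simp: add.assoc)
      then show "c1 = 0 \<and> c2 = 0 \<and> c3 = 0 \<and> c4 = 0" using 1(3) 2(3) by blast
    qed
    then show ?thesis using that by blast
  qed
  interpret AB: frame A B by fact
  have decomp: "\<exists>x\<in>L1. \<exists>y\<in>L2. h = x + y" for h
  proof -
    have "h = ((B *v h) $ 1 *s u1 + (B *v h) $ 2 *s v1) + ((B *v h) $ 3 *s u2 + (B *v h) $ 4 *s v2)"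
      using AB(2)[of "B *v h"] by (simp add: AB.AB_vec add.assoc)
    then show ?thesis using comb 1(1,2) 2(1,2) sub by blast
  qed
  obtain x1 y1 where xy1: "x1 \<in> L1" "y1 \<in> L2" "u3 = x1 + y1" using decomp by blast
  obtain x2 y2 where xy2: "x2 \<in> L1" "y2 \<in> L2" "v3 = x2 + y2" using decomp by blast
  \<comment> \<open>A relation between the components in \<open>L1\<close> would put a vector of
    \<open>L3\<close> into \<open>L2\<close>.\<close>
  have indx: "c = 0 \<and> d = 0" if "c *s x1 + d *s x2 = 0" for c d
  proof -
    have "c *s u3 + d *s v3 = c *s y1 + d *s y2"
      using that by (simp add: xy1 xy2 vec_eq_iff algebra_simps)
    then have "c *s u3 + d *s v3 \<in> L2 \<inter> L3"
      using comb[OF sub(2) xy1(2) xy2(2), of c d] comb[OF sub(3) 3(1,2), of c d] by simp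
    then show ?thesis using disj(3) 3(3) by blast
  qed
  have indy: "c = 0 \<and> d = 0" if "c *s y1 + d *s y2 = 0" for c d
  proof -
    have "c *s u3 + d *s v3 = c *s x1 + d *s x2"
      using that by (simp add: xy1 xy2 vec_eq_iff algebra_simps)
    then have "c *s u3 + d *s v3 \<in> L1 \<inter> L3"
      using comb[OF sub(1) xy1(1) xy2(1), of c d] comb[OF sub(3) 3(1,2), of c d] by simp
    then show ?thesis using disj(2) 3(3) by blast
  qed
  have "\<exists>A B. frame A B \<and>
    (\<forall>c. A *v c = c $ 1 *s x1 + c $ 2 *s x2 + c $ 3 *s y1 + c $ 4 *s y2)"
  proof (rule frame_of_columns)
    fix c1 c2 c3 c4 assume "c1 *s x1 + c2 *s x2 + c3 *s y1 + c4 *s y2 = 0"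
    then have "c1 *s x1 + c2 *s x2 = 0 \<and> c3 *s y1 + c4 *s y2 = 0"
      using comb xy1 xy2 sub by (intro zero) (auto simp: add.assoc)
    then show "c1 = 0 \<and> c2 = 0 \<and> c3 = 0 \<and> c4 = 0" using indx indy by blast
  qed
  then obtain A' B' where AB': "frame A' B'"
    "\<And>c. A' *v c = c $ 1 *s x1 + c $ 2 *s x2 + c $ 3 *s y1 + c $ 4 *s y2" by blast
  interpret AB': frame A' B' by fact
  have pts: "pt A' axis1 x = x $ 1 *s x1 + x $ 2 *s x2" "pt A' axis2 x = x $ 1 *s y1 + x $ 2 *s y2"
    "pt A' (axis1 + axis2) x = x $ 1 *s u3 + x $ 2 *s v3" for x
    by (simp_all add: pt_def AB'(2) xy1 xy2 vec.scale_right_distrib del: AB'.pt_add)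
  have "AB'.ruling axis1 \<subseteq> L1" "AB'.ruling axis2 \<subseteq> L2" "AB'.ruling (axis1 + axis2) \<subseteq> L3"
    unfolding AB'.ruling_def using comb xy1 xy2 3(1,2) sub pts by auto
  then show ?thesis using AB'.proj_line_ruling lines line_subset_eq AB'(1) axis_nonzero by metis
qed

lemma obtain_three:
  assumes "card S \<ge> 3" "x \<in> S"
  obtains y z where "y \<in> S" "z \<in> S" "x \<noteq> y" "x \<noteq> z" "y \<noteq> z"
proof -
  have "card (S - {x}) \<ge> 2" using assms by (simp add: card_Diff_singleton)
  then obtain T where "T \<subseteq> S - {x}" "card T = 2" by (metis obtain_subset_with_card_n)
  then show ?thesis using that by (auto simp: card_2_iff)
qed

lemma skew_lines_frame:
  assumes "skew_lines \<L>" "L1 \<in> \<L>" "L2 \<in> \<L>" "L3 \<in> \<L>" "L1 \<noteq> L2" "L1 \<noteq> L3" "L2 \<noteq> L3"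
  shows "\<exists>A B. frame A B \<and> L1 = frame.ruling A axis1 \<and> L2 = frame.ruling A axis2 \<and>
    L3 = frame.ruling A (axis1 + axis2)"
proof (rule exists_frame)
  show "proj_line L1" "proj_line L2" "proj_line L3" using assms by (auto simp: skew_lines_def)
  show "L1 \<inter> L2 \<subseteq> {0}" "L1 \<inter> L3 \<subseteq> {0}" "L2 \<inter> L3 \<subseteq> {0}"
    using skew_linesD[OF assms(1)] assms(2-) by blast+
qed

section \<open>Trivial groupoids and lines in one ruling\<close>

context frame begin

lemma span_pt_in_ruling: "\<sigma> \<noteq> 0 \<Longrightarrow> u \<noteq> 0 \<Longrightarrow> vec.span {pt A \<sigma> u} \<in> points_on (ruling \<sigma>)"
  using vec.span_minimal[OF _ subspace_ruling[of \<sigma>], of "{pt A \<sigma> u}"]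
  by (simp add: points_on_def pt_eq_0_iff proj_point_span)

lemma point_on_rulingE:
  assumes "p \<in> points_on (ruling \<sigma>)"
  obtains u where "u \<noteq> 0" "p = vec.span {pt A \<sigma> u}"
proof -
  obtain v where v: "v \<noteq> 0" "p = vec.span {v}" "p \<subseteq> ruling \<sigma>"
    using assms proj_pointE unfolding points_on_def by blast
  then have "v \<in> ruling \<sigma>" using vec.span_base[of v "{v}"] by blast
  then obtain u where u: "v = pt A \<sigma> u" by (auto simp: ruling_def)
  then have "u \<noteq> 0" using v(1) by auto
  then show ?thesis using that u v(2) by blast
qed

lemma in_oppE:
  assumes "v \<in> opp u" "v \<noteq> 0"
  obtains \<sigma> where "\<sigma> \<noteq> 0" "v = pt A \<sigma> u"
proof -
  obtain \<sigma> where "v = pt A \<sigma> u" using assms(1) by (auto simp: opp_def)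
  moreover from this have "\<sigma> \<noteq> 0" using assms(2) by auto
  ultimately show ?thesis using that by blast
qed

text \<open>By induction every arrow preserves the coordinate \<open>u\<close>, so an arrow from a
  line to itself fixes all points; extensionality makes it equal to the identity.\<close>

lemma trivial_group_if_ruling:
  assumes "\<And>L. L \<in> \<L> \<Longrightarrow> \<exists>\<sigma>. \<sigma> \<noteq> 0 \<and> L = ruling \<sigma>" "L \<in> \<L>"
  shows "Coset.order (groupoid_group \<L> L) = 1"
proof -
  obtain s where s: "\<And>L. L \<in> \<L> \<Longrightarrow> s L \<noteq> 0" "\<And>L. L \<in> \<L> \<Longrightarrow> L = ruling (s L)"
    using assms(1) by metis
  have pts: "vec.span {pt A (s L) u} \<in> points_on L" if "L \<in> \<L>" "u \<noteq> 0" for L u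
    using span_pt_in_ruling[OF s(1)[OF that(1)] that(2)] s(2)[OF that(1)] by metis
  have indep: "det2 (s L) (s M) \<noteq> 0" if "L \<in> \<L>" "M \<in> \<L>" "L \<noteq> M" for L M
    using ruling_proportional s that by metis
  have arrow: "L \<in> \<L> \<and> M \<in> \<L> \<and> f \<in> extensional (points_on L) \<and>
      (\<forall>u. u \<noteq> 0 \<longrightarrow> f (vec.span {pt A (s L) u}) = vec.span {pt A (s M) u})"
    if "groupoid_arrow \<L> L M f" for L M f
    using that
  proof induction
    case (identity L)
    then show ?case using pts by (simp add: extensional_def)
  next
    case (generator L M N)
    have "line_map L M N (vec.span {pt A (s L) u}) = vec.span {pt A (s M) u}" if "u \<noteq> 0" for u
      using line_map_ruling[OF indep[of L N] indep[of M N] that] generator s(2) by metis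
    moreover have "line_map L M N \<in> extensional (points_on L)" by (simp add: line_map_def)
    ultimately show ?case using generator by simp
  next
    case (composition L M f N g)
    then show ?case using pts by (simp add: compose_eq)
  qed
  have "carrier (groupoid_group \<L> L) = {\<lambda>p\<in>points_on L. p}"
  proof
    show "{\<lambda>p\<in>points_on L. p} \<subseteq> carrier (groupoid_group \<L> L)"
      using groupoid_arrow.identity[OF assms(2)] by (simp add: groupoid_group_def)
    show "carrier (groupoid_group \<L> L) \<subseteq> {\<lambda>p\<in>points_on L. p}"
    proof
      fix f assume "f \<in> carrier (groupoid_group \<L> L)"
      then have f: "f \<in> extensional (points_on L)"
        "\<And>u. u \<noteq> 0 \<Longrightarrow> f (vec.span {pt A (s L) u}) = vec.span {pt A (s L) u}"
        using arrow[of L L f] by (auto simp: groupoid_group_def)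
      have "f = (\<lambda>p\<in>points_on L. p)"
      proof (rule extensionalityI[OF f(1)])
        fix p assume p: "p \<in> points_on L"
        then obtain u where "u \<noteq> 0" "p = vec.span {pt A (s L) u}"
          using point_on_rulingE[of p "s L"] s(2)[OF assms(2)] by metis
        then show "f p = (\<lambda>p\<in>points_on L. p) p" using f(2) p by simp
      qed simp
      then show "f \<in> {\<lambda>p\<in>points_on L. p}" by simp
    qed
  qed
  then show ?thesis by (simp add: Coset.order_def)
qed

end

text \<open>Three of the lines determine a quadric. For any further line \<open>L\<close>, going to
  \<open>L2\<close> along planes through \<open>L3\<close> and back along planes through
  \<open>L\<close> is the identity, which makes \<open>L\<close> meet every opposite line; three of
  these suffice for \<open>line_in_ruling\<close>.\<close>

lemma trivial_group_imp_ruling: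
  assumes L: "skew_lines \<L>" "card \<L> \<ge> 3" "L0 \<in> \<L>"
    and triv: "Coset.order (groupoid_group \<L> L0) = 1"
  shows "\<exists>A B. frame A B \<and> (\<forall>L\<in>\<L>. \<exists>\<sigma>. \<sigma> \<noteq> 0 \<and> L = frame.ruling A \<sigma>)"
proof -
  obtain L2 L3 where L23: "L2 \<in> \<L>" "L3 \<in> \<L>" "L0 \<noteq> L2" "L0 \<noteq> L3" "L2 \<noteq> L3"
    using obtain_three[OF L(2,3)] by metis
  obtain A B where fr: "frame A B" "L0 = frame.ruling A axis1" "L2 = frame.ruling A axis2"
    "L3 = frame.ruling A (axis1 + axis2)"
    using skew_lines_frame[OF L(1,3) L23] by blast
  interpret frame A B by fact
  have "carrier (groupoid_group \<L> L0) = {\<lambda>p\<in>points_on L0. p}"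
  proof -
    obtain g where "carrier (groupoid_group \<L> L0) = {g}"
      using triv by (auto simp: Coset.order_def card_1_singleton_iff)
    moreover have "(\<lambda>p\<in>points_on L0. p) \<in> carrier (groupoid_group \<L> L0)"
      using groupoid_arrow.identity[OF L(3)] by (simp add: groupoid_group_def)
    ultimately show ?thesis by auto
  qed
  then have id: "f = (\<lambda>p\<in>points_on L0. p)" if "groupoid_arrow \<L> L0 L0 f" for f
    using that by (auto simp: groupoid_group_def)
  have "\<exists>\<sigma>. \<sigma> \<noteq> 0 \<and> L = ruling \<sigma>" if "L \<in> \<L>" for L
  proof (cases "L \<in> {L0, L2, L3}")
    case True
    then consider "L = ruling axis1" | "L = ruling axis2" | "L = ruling (axis1 + axis2)"
      using fr by blast
    then show ?thesis by cases (use axis_nonzero in blast)+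
  next
    case False
    have meet: "\<exists>\<sigma>. \<sigma> \<noteq> 0 \<and> pt A \<sigma> u \<in> L" if "u \<noteq> 0" for u
    proof -
      let ?p = "vec.span {pt A axis1 u}" and ?q = "vec.span {pt A axis2 u}"
      have p: "?p \<in> points_on L0" and q: "?q \<in> points_on L2"
        using span_pt_in_ruling[OF _ that] fr by auto
      have "groupoid_arrow \<L> L0 L0 (compose (points_on L0) (line_map L2 L0 L) (line_map L0 L2 L3))"
        using False \<open>L \<in> \<L>\<close> L L23
        by (intro groupoid_arrow.composition[of _ _ L2] groupoid_arrow.generator) auto
      from fun_cong[OF id[OF this], of ?p] have "line_map L2 L0 L (line_map L0 L2 L3 ?p) = ?p"
        using p by (simp add: compose_eq)
      moreover have "line_map L0 L2 L3 ?p = ?q"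
        unfolding fr(2-4) using that by (intro line_map_ruling) simp_all
      ultimately have "vec.span (?q \<union> L) \<inter> L0 = ?p" using q by (simp add: line_map_def)
      then have "pt A axis1 u \<in> vec.span (?q \<union> L)"
        using vec.span_base[of "pt A axis1 u" "{pt A axis1 u}"] by blast
      moreover have "vec.subspace L"
        using L(1) \<open>L \<in> \<L>\<close> by (auto simp: skew_lines_def proj_line_def)
      \<comment> \<open>The plane through \<open>L\<close> and the point on \<open>L2\<close>
        contains the point on \<open>L0\<close>, so the line joining these two points meets
        \<open>L\<close>.\<close>
      ultimately obtain c where "pt A axis1 u - c *s pt A axis2 u \<in> L"
        using span_point_subspace by blast
      then have "pt A (axis1 - c *s axis2) u \<in> L" by simp
      then show ?thesis using axis_nonzero(4) by blast
    qed
    obtain \<rho> \<sigma> \<tau> where "\<rho> \<noteq> 0" "pt A \<rho> axis1 \<in> L" "\<sigma> \<noteq> 0" "pt A \<sigma> axis2 \<in> L"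
      "\<tau> \<noteq> 0" "pt A \<tau> (axis1 + axis2) \<in> L"
      using meet axis_nonzero(1-3) by metis
    moreover have "proj_line L" using L(1) \<open>L \<in> \<L>\<close> by (auto simp: skew_lines_def)
    ultimately show ?thesis
      by (intro line_in_ruling[of L axis1 axis2 "axis1 + axis2"]) simp_all
  qed
  then show ?thesis using fr(1) by blast
qed

text \<open>Three lines of \<open>\<L>\<close> give a frame. A line meeting all three is an opposite
  line, and any line meeting three opposite lines is in the ruling.\<close>

lemma transversals_imp_ruling:
  assumes L: "skew_lines \<L>" "card \<L> \<ge> 3" and T: "skew_lines \<T>" "card \<T> \<ge> 3"
    and meet: "\<And>T L. T \<in> \<T> \<Longrightarrow> L \<in> \<L> \<Longrightarrow> points_on T \<inter> points_on L \<noteq> {}"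
  shows "\<exists>A B. frame A B \<and> (\<forall>L\<in>\<L>. \<exists>\<sigma>. \<sigma> \<noteq> 0 \<and> L = frame.ruling A \<sigma>) \<and>
    (\<forall>T\<in>\<T>. \<exists>u. u \<noteq> 0 \<and> T = frame.opp A u)"
proof -
  have lines: "proj_line M" if "M \<in> \<L> \<or> M \<in> \<T>" for M
    using that L T by (auto simp: skew_lines_def)
  have meet': "\<exists>v. v \<noteq> 0 \<and> v \<in> T \<and> v \<in> L" if "T \<in> \<T>" "L \<in> \<L>" for T L
    using meet[OF that] points_on_meet[of T L] lines that by blast
  obtain L1 where "L1 \<in> \<L>" using L(2) by fastforce
  moreover obtain L2 L3 where "L2 \<in> \<L>" "L3 \<in> \<L>" "L1 \<noteq> L2" "L1 \<noteq> L3" "L2 \<noteq> L3"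
    using obtain_three[OF L(2) \<open>L1 \<in> \<L>\<close>] by metis
  ultimately obtain A B where fr: "frame A B" "L1 = frame.ruling A axis1"
    "L2 = frame.ruling A axis2" "L3 = frame.ruling A (axis1 + axis2)" and L123: "L1 \<in> \<L>" "L2 \<in> \<L>" "L3 \<in> \<L>"
    using skew_lines_frame[OF L(1)] by metis
  interpret frame A B by fact
  have opp: "\<exists>u. u \<noteq> 0 \<and> T = opp u" if T: "T \<in> \<T>" for T
  proof -
    obtain u v w where uvw: "pt A axis1 u \<noteq> 0" "pt A axis1 u \<in> T" "pt A axis2 v \<noteq> 0" "pt A axis2 v \<in> T"
      "pt A (axis1 + axis2) w \<noteq> 0" "pt A (axis1 + axis2) w \<in> T"
      using meet'[OF T L123(1)] meet'[OF T L123(2)] meet'[OF T L123(3)]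
      unfolding fr(2-4) ruling_def by blast
    have ind: "pt A axis1 x + pt A axis2 y = 0 \<Longrightarrow> x = 0 \<and> y = 0" for x y
    proof -
      assume *: "pt A axis1 x + pt A axis2 y = 0"
      have "ev B axis2 (pt A axis1 x + pt A axis2 y) = 0" "ev B axis1 (pt A axis1 x + pt A axis2 y) = 0"
        unfolding * by simp_all
      then show "x = 0 \<and> y = 0" by simp
    qed
    have "T = {c *s pt A axis1 u + d *s pt A axis2 v | c d. True}"
    proof (rule line_eqI)
      fix c d assume "c *s pt A axis1 u + d *s pt A axis2 v = 0"
      then have "c *s u = 0 \<and> d *s v = 0" using ind[of "c *s u" "d *s v"] by simp
      then show "c = 0 \<and> d = 0" using uvw by auto
    qed (use lines T uvw in auto)
    then obtain c d where cd: "pt A (axis1 + axis2) w = c *s pt A axis1 u + d *s pt A axis2 v"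
      using uvw(6) by blast
    \<comment> \<open>Projecting the third meeting point from the first two lines shows that all
      three meeting points share the coordinate \<open>w\<close> up to scalars.\<close>
    have "ev B axis2 (pt A (axis1 + axis2) w) = c *s u" "ev B axis1 (pt A (axis1 + axis2) w) = - d *s v"
      unfolding cd by simp_all
    then have w: "w = c *s u" "w = d *s v" by simp_all
    have Ts: "vec.subspace T" using lines T by (simp add: proj_line_def)
    have "c *s pt A axis1 u \<in> T" "d *s pt A axis2 v \<in> T"
      using uvw Ts by (simp_all add: vec.subspace_scale)
    then have "pt A axis1 w \<in> T" "pt A axis2 w \<in> T"
      using w by (metis pt_scale(1))+
    then have "opp w \<subseteq> T" using Ts unfolding opp_eq by (auto intro: vec.subspace_add vec.subspace_scale)
    moreover have "w \<noteq> 0" using uvw(5) by auto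
    ultimately show ?thesis using line_subset_eq[OF proj_line_opp] lines T by blast
  qed
  moreover have "\<exists>\<sigma>. \<sigma> \<noteq> 0 \<and> L = ruling \<sigma>" if "L \<in> \<L>" for L
  proof -
    have meet_opp: "\<exists>u \<sigma>. u \<noteq> 0 \<and> T = opp u \<and> \<sigma> \<noteq> 0 \<and> pt A \<sigma> u \<in> L" if T: "T \<in> \<T>" for T
    proof -
      obtain u where u: "u \<noteq> 0" "T = opp u" using opp[OF T] by blast
      obtain v where "v \<noteq> 0" "v \<in> T" "v \<in> L" using meet'[OF T \<open>L \<in> \<L>\<close>] by blast
      then show ?thesis using u in_oppE[of v u] by metis
    qed
    obtain T1 where T1: "T1 \<in> \<T>" using T(2) by fastforce
    then obtain T2 T3 where T23: "T2 \<in> \<T>" "T3 \<in> \<T>" "T1 \<noteq> T2" "T1 \<noteq> T3" "T2 \<noteq> T3"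
      using obtain_three[OF T(2)] by metis
    obtain u \<rho> where u: "u \<noteq> 0" "T1 = opp u" "\<rho> \<noteq> 0" "pt A \<rho> u \<in> L"
      using meet_opp[OF T1] by blast
    obtain v \<sigma> where v: "v \<noteq> 0" "T2 = opp v" "\<sigma> \<noteq> 0" "pt A \<sigma> v \<in> L"
      using meet_opp[OF T23(1)] by blast
    obtain w \<tau> where w: "w \<noteq> 0" "T3 = opp w" "\<tau> \<noteq> 0" "pt A \<tau> w \<in> L"
      using meet_opp[OF T23(2)] by blast
    have "det2 u v \<noteq> 0" "det2 u w \<noteq> 0" "det2 v w \<noteq> 0"
      using opp_proportional[OF u(1) v(1)] opp_proportional[OF u(1) w(1)]
        opp_proportional[OF v(1) w(1)] u(2) v(2) w(2) T23(3-5) by auto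
    then show ?thesis
      using line_in_ruling[of L u v w] lines \<open>L \<in> \<L>\<close> u(3,4) v(3,4) w(3,4) by blast
  qed
  ultimately show ?thesis using fr(1) by blast
qed

section \<open>Extension of scalars\<close>

definition ac_vec :: "'a::field ^ 'n \<Rightarrow> 'a alg_closure ^ 'n"
  where "ac_vec v = (\<chi> i. to_ac (v $ i))"

lemma ac_vec_nth [simp]: "ac_vec v $ i = to_ac (v $ i)"
  by (simp add: ac_vec_def)

lemma ac_vec_scale: "ac_vec (c *s v) = to_ac c *s ac_vec v"
  by (simp add: vec_eq_iff)

lemma ac_vec_eq_iff [simp]: "ac_vec v = ac_vec w \<longleftrightarrow> v = w"
  by (simp add: vec_eq_iff)

lemma ac_vec_eq_0_iff [simp]: "ac_vec v = 0 \<longleftrightarrow> v = 0"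
  by (simp add: vec_eq_iff)

lemma det2_ac_vec [simp]: "det2 (ac_vec x) (ac_vec y) = to_ac (det2 x y)"
  by (simp add: det2_def)

lemma base_change_span: "base_change (vec.span {v}) = vec.span {ac_vec v}"
proof -
  have "base_change (vec.span {v}) = vec.span (ac_vec ` vec.span {v})"
    by (simp add: base_change_def ac_vec_def[abs_def])
  also have "\<dots> = vec.span {ac_vec v}"
  proof
    have "ac_vec ` vec.span {v} \<subseteq> vec.span {ac_vec v}"
      by (auto simp: vec.span_singleton ac_vec_scale)
    then show "vec.span (ac_vec ` vec.span {v}) \<subseteq> vec.span {ac_vec v}"
      by (intro vec.span_minimal vec.subspace_span)
    show "vec.span {ac_vec v} \<subseteq> vec.span (ac_vec ` vec.span {v})"
      by (intro vec.span_mono) (auto simp: vec.span_base)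
  qed
  finally show ?thesis .
qed

text \<open>The scalar relating two representatives over the closure is a quotient of coordinates in
  the smaller field, so proportionality descends.\<close>

lemma inj_on_base_change: "inj_on base_change {p. proj_point p}"
proof (rule inj_onI)
  fix p q :: "('a ^ 'b) set"
  assume pq: "p \<in> {p. proj_point p}" "q \<in> {p. proj_point p}" "base_change p = base_change q"
  obtain v where v: "v \<noteq> 0" "p = vec.span {v}" using pq(1) proj_pointE by blast
  obtain w where w: "w \<noteq> 0" "q = vec.span {w}" using pq(2) proj_pointE by blast
  have "vec.span {ac_vec v} = vec.span {ac_vec w}"
    using pq(3) by (simp add: v w base_change_span)
  then obtain c where c: "ac_vec v = c *s ac_vec w" "c \<noteq> 0"
    using span_singleton_eq_iff[of "ac_vec v"] v(1) by auto
  obtain i where i: "w $ i \<noteq> 0" using w(1) by (auto simp: vec_eq_iff)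
  have "to_ac (v $ i) = c * to_ac (w $ i)" using arg_cong[OF c(1), of "\<lambda>x. x $ i"] by simp
  then have "c = to_ac (v $ i / w $ i)" using i by simp
  then have "ac_vec v = ac_vec ((v $ i / w $ i) *s w)" using c(1) by (simp only: ac_vec_scale)
  then have "v = (v $ i / w $ i) *s w" by (simp only: ac_vec_eq_iff)
  then show "p = q" using v w span_singleton_eq_iff[OF v(1), of w]
    by (metis vec.scale_zero_left)
qed

definition ac_mat :: "'a::field ^ 'n ^ 'm \<Rightarrow> 'a alg_closure ^ 'n ^ 'm"
  where "ac_mat A = (\<chi> i j. to_ac (A $ i $ j))"

lemma ac_mat_mult: "ac_mat (A ** B) = ac_mat A ** ac_mat B"
  by (simp add: ac_mat_def matrix_matrix_mult_def vec_eq_iff to_ac_sum)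

lemma ac_mat_mult_vec: "ac_mat A *v ac_vec v = ac_vec (A *v v)"
  by (simp add: ac_mat_def matrix_vector_mult_def vec_eq_iff to_ac_sum)

lemma frame_ac_mat: "frame A B \<Longrightarrow> frame (ac_mat A) (ac_mat B)"
  by (simp add: frame_def flip: ac_mat_mult) (simp add: ac_mat_def mat_def vec_eq_iff)

lemma pt_ac_vec: "pt (ac_mat A) (ac_vec \<sigma>) (ac_vec x) = ac_vec (pt A \<sigma> x)"
  unfolding pt_def ac_mat_mult_vec[symmetric]
  by (rule arg_cong[where f = "(*v) (ac_mat A)"]) (simp add: vec_eq_iff)

text \<open>The frame is extended to the algebraic closure, where \<open>geproci_transversal\<close>
  applies; its conclusion descends because \<open>det2\<close> commutes with the embedding of
  fields.\<close>

lemma geproci_closed: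
  fixes Z :: "('k::field ^ 4) set set"
  assumes "frame A B" and gp: "geproci a b (base_change ` Z)"
    and ab: "a \<ge> 1" "b \<ge> 3"
    and \<L>: "finite \<L>" "card \<L> = b"
    and s: "\<And>L. L \<in> \<L> \<Longrightarrow> s L \<noteq> 0" "\<And>L. L \<in> \<L> \<Longrightarrow> L = frame.ruling A (s L)"
    and card: "\<And>L. L \<in> \<L> \<Longrightarrow> card (Z \<inter> points_on L) = a"
    and LM: "L \<in> \<L>" "M \<in> \<L>" and u: "u \<noteq> 0" "vec.span {pt A (s L) u} \<in> Z"
  shows "vec.span {pt A (s M) u} \<in> Z"
proof -
  interpret frame A B by fact
  \<comment> \<open>One coordinate vector is fixed for each point, so that \<open>U N\<close> below
    has exactly \<open>a\<close> members.\<close>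
  define rep where "rep N p = (SOME v. v \<noteq> 0 \<and> p = vec.span {pt A (s N) v})" for N p
  have rep: "rep N p \<noteq> 0 \<and> p = vec.span {pt A (s N) (rep N p)}"
    if "N \<in> \<L>" "p \<in> points_on N" for N p
  proof -
    have "\<exists>v. v \<noteq> 0 \<and> p = vec.span {pt A (s N) v}"
      using point_on_rulingE[of p "s N"] that s(2) by metis
    then show ?thesis unfolding rep_def by (rule someI_ex)
  qed
  define U where "U N = rep N ` (Z \<inter> points_on N)" for N
  have U: "v \<noteq> 0 \<and> vec.span {pt A (s N) v} \<in> Z" if "N \<in> \<L>" "v \<in> U N" for N v
    using that rep unfolding U_def by force
  have inj_rep: "inj_on (rep N) (Z \<inter> points_on N)" if "N \<in> \<L>" for N
    using rep[OF that] by (metis (no_types, lifting) IntD2 inj_onI)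
  have card_U: "card (U N) = a" if "N \<in> \<L>" for N
    using card_image[OF inj_rep[OF that]] card[OF that] by (simp add: U_def)
  have indep_U: "pairwise_indep (U N)" if N: "N \<in> \<L>" for N
    unfolding pairwise_indep_def
  proof (intro ballI impI notI)
    fix v w assume vw: "v \<in> U N" "w \<in> U N" "v \<noteq> w" "det2 v w = 0"
    then obtain p q where pq: "p \<in> points_on N" "q \<in> points_on N" "v = rep N p" "w = rep N q"
      unfolding U_def by blast
    have "vec.span {pt A (s N) v} = vec.span {pt A (s N) w}"
      using U[OF N] vw by (intro span_pt_proportional) auto
    then have "p = q" using rep[OF N pq(1)] rep[OF N pq(2)] pq(3,4) by simp
    then show False using pq vw(3) by simp
  qed
  define f where "f N = ac_vec (s N)" for N
  have indep_s: "det2 (s N) (s N') \<noteq> 0" if "N \<in> \<L>" "N' \<in> \<L>" "N \<noteq> N'" for N N'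
    using ruling_proportional s that by metis
  have inj_f: "inj_on f \<L>"
  proof (rule inj_onI, rule ccontr)
    fix N N' assume "N \<in> \<L>" "N' \<in> \<L>" "f N = f N'" "N \<noteq> N'"
    then show False using indep_s[of N N'] by (simp add: f_def)
  qed
  \<comment> \<open>The families are reindexed by coordinate vectors of lines, as
    \<open>geproci_transversal\<close> requires; \<open>f\<close> is injective on
    \<open>\<L>\<close>.\<close>
  define U' where "U' \<sigma> = ac_vec ` U (inv_into \<L> f \<sigma>)" for \<sigma>
  have U': "U' (f N) = ac_vec ` U N" if "N \<in> \<L>" for N
    using that inj_f by (simp add: U'_def inv_into_f_f)
  have inj_ac: "inj_on ac_vec Y" for Y :: "('k ^ 2) set" by (rule inj_onI) simp
  \<comment> \<open>The given \<open>u\<close> may differ from the representative chosen in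
    \<open>U L\<close>. It is exchanged for \<open>v\<close>, and proportionality restores
    \<open>u\<close> at the end.\<close>
  define v where "v = rep L (vec.span {pt A (s L) u})"
  have pL: "vec.span {pt A (s L) u} \<in> points_on L"
    using span_pt_in_ruling[OF s(1)[OF LM(1)] u(1)] s(2)[OF LM(1)] by metis
  have v: "v \<in> U L" "v \<noteq> 0" "vec.span {pt A (s L) u} = vec.span {pt A (s L) v}"
    using rep[OF LM(1) pL] u(2) pL by (auto simp: v_def U_def)
  have "\<exists>w'\<in>U' (f M). det2 (ac_vec v) w' = 0"
  proof (rule geproci_transversal[OF frame_ac_mat[OF assms(1)] gp, where S = "f ` \<L>" and i = "f L"])
    show "card (f ` \<L>) = b" using card_image[OF inj_f] \<L>(2) by simp
    show "pairwise_indep (f ` \<L>)" using indep_s by (auto simp: pairwise_indep_def f_def)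
    show "0 \<notin> f ` \<L>" using s(1) by (auto simp: f_def)
    show "finite (U' \<sigma>) \<and> card (U' \<sigma>) = a \<and> pairwise_indep (U' \<sigma>) \<and> 0 \<notin> U' \<sigma>" if \<sigma>: "\<sigma> \<in> f ` \<L>" for \<sigma>
    proof -
      obtain N where N: "N \<in> \<L>" "\<sigma> = f N" using \<sigma> by blast
      have "finite (U N)" using card_U[OF N(1)] ab(1) card_ge_0_finite[of "U N"] by simp
      then show ?thesis using card_U[OF N(1)] indep_U[OF N(1)] U[OF N(1)] card_image[OF inj_ac]
        unfolding N(2) U'[OF N(1)] by (auto simp: pairwise_indep_def)
    qed
    show "vec.span {pt (ac_mat A) \<sigma> x} \<in> base_change ` Z" if \<sigma>: "\<sigma> \<in> f ` \<L>" "x \<in> U' \<sigma>" for \<sigma> x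
    proof -
      obtain N where N: "N \<in> \<L>" "\<sigma> = f N" using \<sigma>(1) by blast
      then obtain y where y: "y \<in> U N" "x = ac_vec y" using \<sigma>(2) U' by auto
      have "vec.span {pt (ac_mat A) \<sigma> x} = base_change (vec.span {pt A (s N) y})"
        by (simp add: N y f_def pt_ac_vec base_change_span)
      then show ?thesis using U[OF N(1) y(1)] by blast
    qed
    show "ac_vec v \<in> U' (f L)" using v(1) U'[OF LM(1)] by simp
  qed (use \<L> ab LM in auto)
  then obtain w where w: "w \<in> U M" "det2 v w = 0" using U'[OF LM(2)] by auto
  have "pt A (s L) u \<noteq> 0" using u(1) s(1) LM(1) by (simp add: pt_eq_0_iff)
  then obtain c where c: "c \<noteq> 0" "pt A (s L) u = c *s pt A (s L) v"
    using span_singleton_eq_iff v(3) by metis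
  then have "det2 u v = 0"
    using pt_eq_imp(2)[of "s L" u "s L" "c *s v"] \<open>pt A (s L) u \<noteq> 0\<close> by simp
  then obtain d where "u = d *s v" using det2_eq_0_iff v(2) by blast
  then have "det2 u w = 0" using w(2) by simp
  then have "vec.span {pt A (s M) u} = vec.span {pt A (s M) w}"
    using u(1) U[OF LM(2) w(1)] by (intro span_pt_proportional) auto
  then show ?thesis using U[OF LM(2) w(1)] by simp
qed

section \<open>Grids and trivial groupoids\<close>

lemma points_on_Int: "points_on A \<inter> points_on B = points_on (A \<inter> B)"
  by (auto simp: points_on_def)

lemma points_on_span_singleton: "v \<noteq> 0 \<Longrightarrow> points_on (vec.span {v}) = {vec.span {v}}"
proof -
  assume v: "v \<noteq> 0"
  have "p = vec.span {v}" if p: "p \<in> points_on (vec.span {v})" for p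
  proof -
    obtain w where w: "w \<noteq> 0" "p = vec.span {w}" "p \<subseteq> vec.span {v}"
      using p proj_pointE unfolding points_on_def by blast
    then obtain c where "w = c *s v" using vec.span_base[of w "{w}"] by (auto simp: vec.span_singleton)
    then show ?thesis using w(1,2) span_singleton_eq_iff[OF w(1), of v] by auto
  qed
  then show ?thesis using v by (auto simp: points_on_def proj_point_span)
qed

text \<open>The second family of the grid consists of the opposite lines through the points of
  \<open>Z\<close> on \<open>L0\<close>; by \<open>geproci_closed\<close> they carry all of
  \<open>Z\<close> and meet the lines of \<open>\<L>\<close> only in \<open>Z\<close>.\<close>

lemma trivial_group_imp_grid:
  fixes Z :: "('k::field ^ 4) set set"
  assumes ab: "a \<ge> 3" "b \<ge> 3" and Z: "\<forall>p\<in>Z. proj_point p" and gp: "geproci a b (base_change ` Z)"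
    and L: "skew_lines \<L>" "card \<L> = b" "\<forall>L\<in>\<L>. card (Z \<inter> points_on L) = a" "L0 \<in> \<L>"
    and triv: "Coset.order (groupoid_group \<L> L0) = 1"
  shows "grid a b Z"
proof -
  obtain A B where fr: "frame A B" "\<forall>L\<in>\<L>. \<exists>\<sigma>. \<sigma> \<noteq> 0 \<and> L = frame.ruling A \<sigma>"
    using trivial_group_imp_ruling[OF L(1) _ L(4) triv] L(2) ab(2) by blast
  interpret frame A B by fact
  obtain s where s: "\<And>L. L \<in> \<L> \<Longrightarrow> s L \<noteq> 0" "\<And>L. L \<in> \<L> \<Longrightarrow> L = ruling (s L)"
    using fr(2) by metis
  have finL: "finite \<L>" using L(1) by (simp add: skew_lines_def)
  have closed: "vec.span {pt A (s M) u} \<in> Z"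
    if "L \<in> \<L>" "M \<in> \<L>" "u \<noteq> 0" "vec.span {pt A (s L) u} \<in> Z" for L M u
    using geproci_closed[OF fr(1) gp _ ab(2) finL L(2) s, of L M u] ab L(3) that by simp
  have inj: "inj_on base_change Z"
    by (rule inj_on_subset[OF inj_on_base_change]) (use Z in auto)
  have cardZ: "card Z = a * b" "finite Z"
    using gp card_image[OF inj] finite_imageD[OF _ inj] by (simp_all add: geproci_def)
  \<comment> \<open>The \<open>b\<close> disjoint groups of \<open>a\<close> points already exhaust
    the \<open>a * b\<close> points of \<open>Z\<close>.\<close>
  have Z_eq: "Z = (\<Union>L\<in>\<L>. Z \<inter> points_on L)"
  proof -
    have "card (\<Union>L\<in>\<L>. Z \<inter> points_on L) = (\<Sum>L\<in>\<L>. card (Z \<inter> points_on L))"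
    proof (rule card_UN_disjoint[OF finL])
      show "\<forall>L\<in>\<L>. finite (Z \<inter> points_on L)" using cardZ(2) by simp
      show "\<forall>L\<in>\<L>. \<forall>M\<in>\<L>. L \<noteq> M \<longrightarrow> (Z \<inter> points_on L) \<inter> (Z \<inter> points_on M) = {}"
        using L(1) unfolding skew_lines_def by blast
    qed
    also have "\<dots> = card Z" using L(2,3) cardZ(1) by simp
    finally have "(\<Union>L\<in>\<L>. Z \<inter> points_on L) = Z" using cardZ(2) by (intro card_subset_eq) auto
    then show ?thesis by simp
  qed
  have pt_on: "vec.span {pt A (s L) u} \<in> points_on L" if "L \<in> \<L>" "u \<noteq> 0" for L u
    using span_pt_in_ruling[OF s(1)[OF that(1)] that(2)] s(2)[OF that(1)] by metis
  have on_ptE: "\<exists>u. u \<noteq> 0 \<and> p = vec.span {pt A (s L) u}" if "L \<in> \<L>" "p \<in> points_on L" for L p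
    using point_on_rulingE[of p "s L"] s(2) that by metis
  have meet: "points_on (opp u) \<inter> points_on L = {vec.span {pt A (s L) u}}"
    if "L \<in> \<L>" "u \<noteq> 0" for L u
    using ruling_Int_opp[of "s L" u] s that points_on_span_singleton[of "pt A (s L) u"]
    by (metis Int_commute points_on_Int pt_eq_0_iff)
  \<comment> \<open>All representatives of a point are kept; \<open>opp\<close> identifies
    proportional ones, so \<open>\<A>\<close> is counted through its bijection with the points on
    \<open>L0\<close>.\<close>
  define \<U> where "\<U> = {u. u \<noteq> 0 \<and> vec.span {pt A (s L0) u} \<in> Z}"
  define \<A> where "\<A> = opp ` \<U>"
  have opp_det: "opp u = opp v \<longleftrightarrow> det2 u v = 0" if "u \<noteq> 0" "v \<noteq> 0" for u v
  proof
    assume "opp u = opp v"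
    then obtain \<tau> where "pt A axis1 u = pt A \<tau> v" using pt_in(2)[of axis1 u] by (auto simp: opp_def)
    moreover have "pt A axis1 u \<noteq> 0" using that by (simp add: pt_eq_0_iff)
    ultimately show "det2 u v = 0" by (rule pt_eq_imp(2))
  qed (use that opp_proportional in blast)
  have span_det: "vec.span {pt A \<sigma> u} = vec.span {pt A \<sigma> v} \<longleftrightarrow> det2 u v = 0"
    if "u \<noteq> 0" "v \<noteq> 0" "\<sigma> \<noteq> 0" for u v \<sigma>
  proof
    have nz: "pt A \<sigma> u \<noteq> 0" using that by (simp add: pt_eq_0_iff)
    assume "vec.span {pt A \<sigma> u} = vec.span {pt A \<sigma> v}"
    then obtain c where "pt A \<sigma> u = c *s pt A \<sigma> v" using span_singleton_eq_iff[OF nz] by blast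
    then have "pt A \<sigma> u = pt A (c *s \<sigma>) v" by simp
    then show "det2 u v = 0" using nz by (rule pt_eq_imp(2))
  qed (use that span_pt_proportional in blast)
  have bij: "bij_betw (\<lambda>T. THE p. p \<in> points_on T \<inter> points_on L0) \<A> (Z \<inter> points_on L0)"
  proof -
    have the: "(THE p. p \<in> points_on (opp u) \<inter> points_on L0) = vec.span {pt A (s L0) u}"
      if "u \<in> \<U>" for u
      using meet[OF L(4), of u] that by (simp add: \<U>_def)
    have "inj_on (\<lambda>T. THE p. p \<in> points_on T \<inter> points_on L0) \<A>"
      using the opp_det span_det s(1)[OF L(4)] by (auto simp: inj_on_def \<A>_def \<U>_def)
    moreover have "(\<lambda>T. THE p. p \<in> points_on T \<inter> points_on L0) ` \<A> = Z \<inter> points_on L0"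
    proof -
      have "(\<lambda>T. THE p. p \<in> points_on T \<inter> points_on L0) ` \<A> = (\<lambda>u. vec.span {pt A (s L0) u}) ` \<U>"
        unfolding \<A>_def image_image using the by (rule image_cong[OF refl])
      also have "\<dots> = Z \<inter> points_on L0"
        using pt_on[OF L(4)] on_ptE[OF L(4)] by (auto simp: \<U>_def)
      finally show ?thesis .
    qed
    ultimately show ?thesis by (simp add: bij_betw_def)
  qed
  have cardA: "card \<A> = a" using bij_betw_same_card[OF bij] L(3,4) by simp
  have finA: "finite \<A>" using cardA ab(1) card_ge_0_finite[of \<A>] by simp
  have skewA: "skew_lines \<A>"
    unfolding skew_lines_def
  proof (intro conjI ballI impI finA)
    fix T assume "T \<in> \<A>"
    then show "proj_line T" using proj_line_opp by (auto simp: \<A>_def \<U>_def)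
  next
    fix T T' assume T: "T \<in> \<A>" "T' \<in> \<A>" "T \<noteq> T'"
    then obtain u v where uv: "u \<noteq> 0" "v \<noteq> 0" "T = opp u" "T' = opp v"
      by (auto simp: \<A>_def \<U>_def)
    have "\<not> (\<exists>x. x \<noteq> 0 \<and> x \<in> T \<and> x \<in> T')"
      using pt_eq_imp(2) opp_det[OF uv(1,2)] T(3) uv by (auto simp: opp_def)
    then show "points_on T \<inter> points_on T' = {}"
      using points_on_meet[of T T'] proj_line_opp uv by blast
  qed
  show ?thesis
    unfolding grid_def
  proof (rule exI[of _ \<A>], rule exI[of _ \<L>], intro conjI ballI)
    show "\<exists>!p. p \<in> points_on T \<inter> points_on L" if TL: "T \<in> \<A>" "L \<in> \<L>" for T L
    proof -
      obtain u where u: "u \<noteq> 0" "T = opp u" using TL(1) by (auto simp: \<A>_def \<U>_def)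
      show ?thesis unfolding u(2) meet[OF TL(2) u(1)] by simp
    qed
    show "Z = (\<Union>T\<in>\<A>. points_on T) \<inter> (\<Union>L\<in>\<L>. points_on L)"
    proof (intro equalityI subsetI)
      fix p assume p: "p \<in> Z"
      then obtain L where L': "L \<in> \<L>" "p \<in> points_on L" using Z_eq by blast
      then obtain u where u: "u \<noteq> 0" "p = vec.span {pt A (s L) u}" using on_ptE by blast
      then have "u \<in> \<U>" using closed[OF L'(1) L(4) u(1)] p by (simp add: \<U>_def)
      moreover have "p \<in> points_on (opp u)" using meet[OF L'(1) u(1)] u(2) by blast
      ultimately show "p \<in> (\<Union>T\<in>\<A>. points_on T) \<inter> (\<Union>L\<in>\<L>. points_on L)"
        using L' by (auto simp: \<A>_def)
    next
      fix p assume "p \<in> (\<Union>T\<in>\<A>. points_on T) \<inter> (\<Union>L\<in>\<L>. points_on L)"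
      then obtain u L where u: "u \<in> \<U>" "p \<in> points_on (opp u)" "L \<in> \<L>" "p \<in> points_on L"
        by (auto simp: \<A>_def)
      then have "p = vec.span {pt A (s L) u}" using meet[of L u] by (auto simp: \<U>_def)
      then show "p \<in> Z" using closed[OF L(4) u(3)] u(1) by (simp add: \<U>_def)
    qed
  qed (use cardA skewA L in auto)
qed

text \<open>If \<open>\<L>\<close> lies inside \<open>\<A>\<close>, the lines of \<open>\<B>\<close>
  are its transversals. Otherwise \<open>\<B>\<close> spans a ruling with \<open>\<A>\<close>
  opposite, and each line of \<open>\<L>\<close> outside \<open>\<A>\<close> meets three lines of
  \<open>\<A>\<close> in points of \<open>Z\<close>, hence is in that ruling.\<close>

lemma grid_imp_trivial_group:
  fixes Z :: "('k::field ^ 4) set set"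
  assumes ab: "a \<ge> 3" "b \<ge> 3" and grid: "grid a b Z"
    and L: "skew_lines \<L>" "card \<L> = b" "\<forall>L\<in>\<L>. card (Z \<inter> points_on L) = a" "L0 \<in> \<L>"
  shows "Coset.order (groupoid_group \<L> L0) = 1"
proof -
  obtain \<A> \<B> where gr: "skew_lines \<A>" "card \<A> = a" "skew_lines \<B>" "card \<B> = b"
    "\<forall>T\<in>\<A>. \<forall>M\<in>\<B>. \<exists>!p. p \<in> points_on T \<inter> points_on M"
    "Z = (\<Union>T\<in>\<A>. points_on T) \<inter> (\<Union>M\<in>\<B>. points_on M)"
    using grid unfolding grid_def by blast
  have meet: "points_on T \<inter> points_on M \<noteq> {}" "points_on M \<inter> points_on T \<noteq> {}"
    if "T \<in> \<A>" "M \<in> \<B>" for T M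
    using gr(5) that by blast+
  show ?thesis
  proof (cases "\<L> \<subseteq> \<A>")
    case True
    then have "skew_lines \<L>" "card \<L> \<ge> 3" "card \<B> \<ge> 3" using L ab gr(4) by auto
    then obtain A B where fr: "frame A B" "\<forall>L\<in>\<L>. \<exists>\<sigma>. \<sigma> \<noteq> 0 \<and> L = frame.ruling A \<sigma>"
      using transversals_imp_ruling[of \<L> \<B>] gr(3) meet True by blast
    then show ?thesis using frame.trivial_group_if_ruling[OF fr(1), of \<L> L0] L(4) by blast
  next
    case False
    obtain A B where fr: "frame A B" "\<forall>M\<in>\<B>. \<exists>\<sigma>. \<sigma> \<noteq> 0 \<and> M = frame.ruling A \<sigma>"
      "\<forall>T\<in>\<A>. \<exists>u. u \<noteq> 0 \<and> T = frame.opp A u"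
      using transversals_imp_ruling[of \<B> \<A>] gr(1-4) ab meet by blast
    interpret frame A B by fact
    have ruling: "\<exists>\<sigma>. \<sigma> \<noteq> 0 \<and> L = ruling \<sigma>" if L': "L \<in> \<L>" "L \<notin> \<A>" for L
    proof -
      have line: "proj_line L" using L(1) L'(1) by (simp add: skew_lines_def)
      have "\<exists>T\<in>\<A>. p \<in> points_on T" if "p \<in> Z" for p using gr(6) that by blast
      then obtain t where t: "\<And>p. p \<in> Z \<Longrightarrow> t p \<in> \<A> \<and> p \<in> points_on (t p)" by metis
      \<comment> \<open>Two points of \<open>L\<close> on the same line of \<open>\<A>\<close> would
        force \<open>L\<close> to be that line.\<close>
      have "inj_on t (Z \<inter> points_on L)"
      proof (rule inj_onI, rule ccontr)
        fix p q assume pq: "p \<in> Z \<inter> points_on L" "q \<in> Z \<inter> points_on L" "t p = t q" "p \<noteq> q"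
        obtain x where x: "x \<noteq> 0" "p = vec.span {x}" using pq(1) proj_pointE by (auto simp: points_on_def)
        obtain y where y: "y \<noteq> 0" "q = vec.span {y}" using pq(2) proj_pointE by (auto simp: points_on_def)
        have xy: "x \<in> L" "y \<in> L" "x \<in> t p" "y \<in> t p"
          using pq t[of p] t[of q] x y vec.span_base[of x "{x}"] vec.span_base[of y "{y}"]
          by (auto simp: points_on_def)
        have ind: "c = 0 \<and> d = 0" if "c *s x + d *s y = 0" for c d
        proof -
          have "c = 0"
          proof (rule ccontr)
            assume "c \<noteq> 0"
            then have "x = (- d / c) *s y"
              using that by (auto simp: vec_eq_iff field_simps eq_neg_iff_add_eq_0)
            moreover from this have "- d / c \<noteq> 0" using x(1) by auto
            ultimately show False using span_singleton_eq_iff[OF x(1), of y] x(2) y(2) pq(4) by blast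
          qed
          then show ?thesis using that y(1) by simp
        qed
        have "L = {c *s x + d *s y | c d. True}" using line_eqI[OF line xy(1,2) ind] .
        also have "\<dots> = t p" using line_eqI[OF _ xy(3,4) ind] t[of p] pq(1) gr(1)
          by (auto simp: skew_lines_def)
        finally show False using t[of p] pq(1) L'(2) by simp
      qed
      then have "card (t ` (Z \<inter> points_on L)) \<ge> 3" using L(3) L'(1) ab(1) by (simp add: card_image)
      moreover from this obtain T1 where T1: "T1 \<in> t ` (Z \<inter> points_on L)" by fastforce
      ultimately obtain T2 T3 where T23: "T2 \<in> t ` (Z \<inter> points_on L)" "T3 \<in> t ` (Z \<inter> points_on L)"
        "T1 \<noteq> T2" "T1 \<noteq> T3" "T2 \<noteq> T3" by (rule obtain_three)
      have meet_opp: "\<exists>u \<sigma>. u \<noteq> 0 \<and> T = opp u \<and> \<sigma> \<noteq> 0 \<and> pt A \<sigma> u \<in> L"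
        if T: "T \<in> t ` (Z \<inter> points_on L)" for T
      proof -
        obtain p where p: "p \<in> points_on L" "p \<in> points_on T" "T \<in> \<A>" using T t by blast
        obtain u where u: "u \<noteq> 0" "T = opp u" using fr(3) p(3) by blast
        obtain v where "v \<noteq> 0" "v \<in> L" "v \<in> T"
          using points_on_meet[OF line, of T] p gr(1) by (auto simp: skew_lines_def)
        then show ?thesis using u in_oppE[of v u] by metis
      qed
      obtain u \<rho> where u: "u \<noteq> 0" "T1 = opp u" "\<rho> \<noteq> 0" "pt A \<rho> u \<in> L"
        using meet_opp[OF T1] by blast
      obtain v \<sigma> where v: "v \<noteq> 0" "T2 = opp v" "\<sigma> \<noteq> 0" "pt A \<sigma> v \<in> L"
        using meet_opp[OF T23(1)] by blast
      obtain w \<tau> where w: "w \<noteq> 0" "T3 = opp w" "\<tau> \<noteq> 0" "pt A \<tau> w \<in> L"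
        using meet_opp[OF T23(2)] by blast
      have "det2 u v \<noteq> 0" "det2 u w \<noteq> 0" "det2 v w \<noteq> 0"
        using opp_proportional[OF u(1) v(1)] opp_proportional[OF u(1) w(1)]
          opp_proportional[OF v(1) w(1)] u(2) v(2) w(2) T23(3-5) by auto
      then show ?thesis using line_in_ruling[of L u v w] line u(3,4) v(3,4) w(3,4) by blast
    qed
    \<comment> \<open>The two families cannot mix in \<open>\<L>\<close>: an opposite line meets
      every line of the ruling, against skewness.\<close>
    have "L \<notin> \<A>" if "L \<in> \<L>" for L
    proof
      assume "L \<in> \<A>"
      then obtain u where u: "u \<noteq> 0" "L = opp u" using fr(3) by blast
      obtain M where M: "M \<in> \<L>" "M \<notin> \<A>" using False by blast
      then obtain \<sigma> where \<sigma>: "\<sigma> \<noteq> 0" "M = ruling \<sigma>" using ruling by blast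
      have "pt A \<sigma> u \<noteq> 0" using u \<sigma> by (simp add: pt_eq_0_iff)
      then have "L = M" using skew_linesD[OF L(1) \<open>L \<in> \<L>\<close> M(1), of "pt A \<sigma> u"] u \<sigma> by simp
      then show False using \<open>L \<in> \<A>\<close> M(2) by simp
    qed
    then show ?thesis using trivial_group_if_ruling[of \<L> L0] ruling L(4) by blast
  qed
qed

theorem corollary3p1p2:
  fixes a b :: nat
    and Z :: "('k::field ^ 4) set set"
    and \<L> :: "('k ^ 4) set set"
    and L\<^sub>0 :: "('k ^ 4) set"
  assumes "a \<ge> 3" and "b \<ge> 3"
    and "\<forall>p\<in>Z. proj_point p"
    and "bracket_geproci a b (base_change ` Z)"
    and "skew_lines \<L>" and "card \<L> = b"
    and "\<forall>L\<in>\<L>. card (Z \<inter> points_on L) = a"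
    and "L\<^sub>0 \<in> \<L>"
  shows "grid a b Z \<longleftrightarrow> Coset.order (groupoid_group \<L> L\<^sub>0) = 1"
proof
  assume "grid a b Z"
  then show "Coset.order (groupoid_group \<L> L\<^sub>0) = 1"
    using assms by (intro grid_imp_trivial_group)
next
  assume "Coset.order (groupoid_group \<L> L\<^sub>0) = 1"
  moreover have "geproci a b (base_change ` Z)"
    using assms(4) by (simp add: bracket_geproci_def)
  ultimately show "grid a b Z"
    using assms by (intro trivial_group_imp_grid[of a b Z \<L> L\<^sub>0])
qed

end
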